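(* Let $\varphi(x,y,\varepsilon)$ be an internal formula, where $y$ has type $\tau$ and $\varepsilon$ ranges over reals. Then there is an internal formula $\theta(u,v)$ (with $u,v$ tuples of variables) such that $\mathsf{P}$ proves $$(\forall\varepsilon\approx 0)(\forall^{\mathrm{st}}x)(\exists^{\mathrm{st}}y^\tau)\varphi(x,y,\varepsilon)\ \leftrightarrow\ (\forall^{\mathrm{st}}u)(\exists^{\mathrm{st}}v)\theta(u,v).$$
   Context: The base theory is $\textsf{E-PA}^{\omega*}$: extensional Peano arithmetic in all finite types (Gödel's system $T$ with recursors for all finite types, full induction, extensionality) with types $\sigma^*$ of finite sequences; reals are represented in the usual way. The language of $\mathsf{P}$ adds predicates $\mathrm{st}_\sigma(x)$ ("$x$ is standard"); $(\forall^{\mathrm{st}}x)\Phi$ abbreviates $(\forall x)(\mathrm{st}(x)\rightarrow\Phi)$, $(\exists^{\mathrm{st}}x)\Phi$ abbreviates $(\exists x)(\mathrm{st}(x)\wedge\Phi)$; a formula is internal if it does not contain $\mathrm{st}$. For a real $\varepsilon$, $\varepsilon\approx0$ means $(\forall^{\mathrm{st}}k^0)(|\varepsilon|<\frac1k)$, and $(\forall\varepsilon\approx0)\Phi$ abbreviates $(\forall\varepsilon)(\varepsilon\approx0\rightarrow\Phi)$. The system $\mathsf{P}$ is $\textsf{E-PA}^{\omega*}$ together with: (i) $\mathrm{st}(x)\wedge x=y\rightarrow\mathrm{st}(y)$; (ii) $\mathrm{st}(t)$ for every closed term $t$; (iii) $\mathrm{st}(f)\wedge\mathrm{st}(x)\rightarrow\mathrm{st}(f(x))$;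 (iv) external induction $\Phi(0)\wedge(\forall^{\mathrm{st}}n^0)(\Phi(n)\rightarrow\Phi(n+1))\rightarrow(\forall^{\mathrm{st}}n^0)\Phi(n)$; (v) Idealisation: for internal $\varphi$ (with arbitrary parameters), $(\forall^{\mathrm{st}}x^{\sigma^*})(\exists y^\tau)(\forall z^\sigma\in x)\varphi(z,y)\rightarrow(\exists y^\tau)(\forall^{\mathrm{st}}x^\sigma)\varphi(x,y)$; (vi) $\mathsf{HAC}_{\mathsf{int}}$: for internal $\varphi$, $(\forall^{\mathrm{st}}x^\rho)(\exists^{\mathrm{st}}y^\tau)\varphi(x,y)\rightarrow(\exists^{\mathrm{st}}F^{\rho\rightarrow\tau^*})(\forall^{\mathrm{st}}x^\rho)(\exists y^\tau\in F(x))\varphi(x,y)$, where $y\in F(x)$ means $y$ is an entry of the finite list $F(x)$. *)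

theory Defs
  imports Main
begin

text \<open>
  A deep embedding of the nonstandard system P over extensional Peano arithmetic in all finite
  types with sequence types.  Variables are de Bruijn indices; a context is the list of the
  types of the free variables, index 0 first.
\<close>

section \<open>Types, terms, formulas\<close>

datatype ty = N | Arr ty ty (infixr \<open>\<leadsto>\<close> 60) | Seq ty

datatype cst =
    Zero | Succ
  | K ty ty | S ty ty ty
  | Rec ty
  | NilC ty | ConsC ty
  | LRec ty ty

text \<open>The recursors take the recursion argument last, so that partial applications are functions
  of it; see the conversion axioms below.\<close>

fun cst_ty :: "cst \<Rightarrow> ty" where
  "cst_ty Zero = N"
| "cst_ty Succ = N \<leadsto> N"
| "cst_ty (K \<sigma> \<tau>) = \<sigma> \<leadsto> \<tau> \<leadsto> \<sigma>"
| "cst_ty (S \<rho> \<sigma> \<tau>) = (\<rho> \<leadsto> \<sigma> \<leadsto> \<tau>) \<leadsto> (\<rho> \<leadsto> \<sigma>) \<leadsto> \<rho> \<leadsto> \<tau>"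
| "cst_ty (Rec \<rho>) = \<rho> \<leadsto> (N \<leadsto> \<rho> \<leadsto> \<rho>) \<leadsto> N \<leadsto> \<rho>"
| "cst_ty (NilC \<sigma>) = Seq \<sigma>"
| "cst_ty (ConsC \<sigma>) = \<sigma> \<leadsto> Seq \<sigma> \<leadsto> Seq \<sigma>"
| "cst_ty (LRec \<sigma> \<rho>) = \<rho> \<leadsto> (\<sigma> \<leadsto> Seq \<sigma> \<leadsto> \<rho> \<leadsto> \<rho>) \<leadsto> Seq \<sigma> \<leadsto> \<rho>"

datatype tm = Var nat | Con cst | App tm tm (infixl \<open>\<cdot>\<close> 75)

inductive has_ty :: "ty list \<Rightarrow> tm \<Rightarrow> ty \<Rightarrow> bool" where
  has_ty_Var: "n < length \<Gamma> \<Longrightarrow> has_ty \<Gamma> (Var n) (\<Gamma> ! n)"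
| has_ty_Con: "has_ty \<Gamma> (Con c) (cst_ty c)"
| has_ty_App: "has_ty \<Gamma> s (\<sigma> \<leadsto> \<tau>) \<Longrightarrow> has_ty \<Gamma> t \<sigma> \<Longrightarrow> has_ty \<Gamma> (s \<cdot> t) \<tau>"

text \<open>Equality is primitive at every type.  \<open>St \<sigma>\<close> is the standardness predicate of type \<open>\<sigma>\<close>.
  The logic is classical, so falsum, implication and \<open>\<forall>\<close> suffice as primitives.\<close>

datatype fm =
    Bot
  | Eql ty tm tm
  | St ty tm
  | Imp fm fm
  | Forall ty fm

fun wf_fm :: "ty list \<Rightarrow> fm \<Rightarrow> bool" where
  "wf_fm \<Gamma> Bot = True"
| "wf_fm \<Gamma> (Eql \<sigma> s t) = (has_ty \<Gamma> s \<sigma> \<and> has_ty \<Gamma> t \<sigma>)"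
| "wf_fm \<Gamma> (St \<sigma> t) = has_ty \<Gamma> t \<sigma>"
| "wf_fm \<Gamma> (Imp \<phi> \<psi>) = (wf_fm \<Gamma> \<phi> \<and> wf_fm \<Gamma> \<psi>)"
| "wf_fm \<Gamma> (Forall \<sigma> \<phi>) = wf_fm (\<sigma> # \<Gamma>) \<phi>"

fun internal :: "fm \<Rightarrow> bool" where
  "internal Bot = True"
| "internal (Eql \<sigma> s t) = True"
| "internal (St \<sigma> t) = False"
| "internal (Imp \<phi> \<psi>) = (internal \<phi> \<and> internal \<psi>)"
| "internal (Forall \<sigma> \<phi>) = internal \<phi>"

definition Neg :: "fm \<Rightarrow> fm" where
  "Neg \<phi> = Imp \<phi> Bot"
definition Conj :: "fm \<Rightarrow> fm \<Rightarrow> fm" where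
  "Conj \<phi> \<psi> = Neg (Imp \<phi> (Neg \<psi>))"
definition Disj :: "fm \<Rightarrow> fm \<Rightarrow> fm" where
  "Disj \<phi> \<psi> = Imp (Neg \<phi>) \<psi>"
definition Iff :: "fm \<Rightarrow> fm \<Rightarrow> fm" where
  "Iff \<phi> \<psi> = Conj (Imp \<phi> \<psi>) (Imp \<psi> \<phi>)"
definition Exists :: "ty \<Rightarrow> fm \<Rightarrow> fm" where
  "Exists \<sigma> \<phi> = Neg (Forall \<sigma> (Neg \<phi>))"
definition AllSt :: "ty \<Rightarrow> fm \<Rightarrow> fm" where
  "AllSt \<sigma> \<phi> = Forall \<sigma> (Imp (St \<sigma> (Var 0)) \<phi>)"
definition ExSt :: "ty \<Rightarrow> fm \<Rightarrow> fm" where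
  "ExSt \<sigma> \<phi> = Exists \<sigma> (Conj (St \<sigma> (Var 0)) \<phi>)"


section \<open>Simultaneous substitution\<close>

fun tsubst :: "(nat \<Rightarrow> tm) \<Rightarrow> tm \<Rightarrow> tm" where
  "tsubst f (Var n) = f n"
| "tsubst f (Con c) = Con c"
| "tsubst f (s \<cdot> t) = tsubst f s \<cdot> tsubst f t"

definition lift :: "nat \<Rightarrow> tm \<Rightarrow> tm" where
  "lift k = tsubst (\<lambda>i. Var (i + k))"

definition up :: "(nat \<Rightarrow> tm) \<Rightarrow> nat \<Rightarrow> tm" where
  "up f n = (case n of 0 \<Rightarrow> Var 0 | Suc m \<Rightarrow> lift 1 (f m))"

fun fsubst :: "(nat \<Rightarrow> tm) \<Rightarrow> fm \<Rightarrow> fm" where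
  "fsubst f Bot = Bot"
| "fsubst f (Eql \<sigma> s t) = Eql \<sigma> (tsubst f s) (tsubst f t)"
| "fsubst f (St \<sigma> t) = St \<sigma> (tsubst f t)"
| "fsubst f (Imp \<phi> \<psi>) = Imp (fsubst f \<phi>) (fsubst f \<psi>)"
| "fsubst f (Forall \<sigma> \<phi>) = Forall \<sigma> (fsubst (up f) \<phi>)"

definition flift :: "fm \<Rightarrow> fm" where
  "flift = fsubst (\<lambda>i. Var (Suc i))"

definition inst :: "tm \<Rightarrow> fm \<Rightarrow> fm" where
  "inst t = fsubst (\<lambda>i. case i of 0 \<Rightarrow> t | Suc m \<Rightarrow> Var m)"

text \<open>\<open>\<phi>(n)\<close>, with \<open>n\<close> the variable 0, becomes \<open>\<phi>(n + 1)\<close> in the same context.\<close>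

definition succ_inst :: "fm \<Rightarrow> fm" where
  "succ_inst = fsubst (\<lambda>i. case i of 0 \<Rightarrow> Con Succ \<cdot> Var 0 | Suc m \<Rightarrow> Var (Suc m))"

text \<open>Weakening by a fresh variable with index 2, below the variables 0 and 1.\<close>

definition weaken2 :: "fm \<Rightarrow> fm" where
  "weaken2 = fsubst (\<lambda>i. Var (if i < 2 then i else Suc i))"


section \<open>Arithmetic and sequences\<close>

abbreviation zero :: tm where "zero \<equiv> Con Zero"
abbreviation suc :: "tm \<Rightarrow> tm" where "suc t \<equiv> Con Succ \<cdot> t"

definition plusF :: "tm \<Rightarrow> tm" where
  "plusF m = Con (Rec N) \<cdot> m \<cdot> (Con (K (N \<leadsto> N) N) \<cdot> Con Succ)"
definition plusT :: "tm \<Rightarrow> tm \<Rightarrow> tm" where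
  "plusT m n = plusF m \<cdot> n"
definition timesF :: "tm \<Rightarrow> tm" where
  "timesF m = Con (Rec N) \<cdot> zero \<cdot> (Con (K (N \<leadsto> N) N) \<cdot> plusF m)"
definition timesT :: "tm \<Rightarrow> tm \<Rightarrow> tm" where
  "timesT m n = timesF m \<cdot> n"
definition twoT :: tm where
  "twoT = suc (suc zero)"
definition pow2T :: "tm \<Rightarrow> tm" where
  "pow2T n = Con (Rec N) \<cdot> suc zero \<cdot> (Con (K (N \<leadsto> N) N) \<cdot> timesF twoT) \<cdot> n"

definition LessF :: "tm \<Rightarrow> tm \<Rightarrow> fm" where
  "LessF m n = Exists N (Eql N (suc (plusT (lift 1 m) (Var 0))) (lift 1 n))"

definition lenT :: "ty \<Rightarrow> tm \<Rightarrow> tm" where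
  "lenT \<sigma> s = Con (LRec \<sigma> N) \<cdot> zero
     \<cdot> (Con (K (Seq \<sigma> \<leadsto> N \<leadsto> N) \<sigma>) \<cdot> (Con (K (N \<leadsto> N) (Seq \<sigma>)) \<cdot> Con Succ)) \<cdot> s"

fun zeroT :: "ty \<Rightarrow> tm" where
  "zeroT N = zero"
| "zeroT (\<sigma> \<leadsto> \<tau>) = Con (K \<tau> \<sigma>) \<cdot> zeroT \<tau>"
| "zeroT (Seq \<sigma>) = Con (NilC \<sigma>)"

text \<open>The step terms are the combinator forms of \<open>\<lambda>a s r. a\<close> and \<open>\<lambda>a s r. s\<close>.  The head of the
  empty sequence is the zero functional, its tail is empty.\<close>

definition headF :: "ty \<Rightarrow> tm" where
  "headF \<sigma> = Con (LRec \<sigma> \<sigma>) \<cdot> zeroT \<sigma>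
     \<cdot> (Con (S \<sigma> (\<sigma> \<leadsto> \<sigma>) (Seq \<sigma> \<leadsto> \<sigma> \<leadsto> \<sigma>))
         \<cdot> (Con (K ((\<sigma> \<leadsto> \<sigma>) \<leadsto> Seq \<sigma> \<leadsto> \<sigma> \<leadsto> \<sigma>) \<sigma>) \<cdot> Con (K (\<sigma> \<leadsto> \<sigma>) (Seq \<sigma>)))
         \<cdot> Con (K \<sigma> \<sigma>))"
definition tailF :: "ty \<Rightarrow> tm" where
  "tailF \<sigma> = Con (LRec \<sigma> (Seq \<sigma>)) \<cdot> Con (NilC \<sigma>)
     \<cdot> (Con (K (Seq \<sigma> \<leadsto> Seq \<sigma> \<leadsto> Seq \<sigma>) \<sigma>) \<cdot> Con (K (Seq \<sigma>) (Seq \<sigma>)))"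

text \<open>The \<open>i\<close>-th entry is the head of the \<open>i\<close>-fold tail.\<close>

definition nthT :: "ty \<Rightarrow> tm \<Rightarrow> tm \<Rightarrow> tm" where
  "nthT \<sigma> s i = headF \<sigma> \<cdot>
     (Con (Rec (Seq \<sigma>)) \<cdot> s \<cdot> (Con (K (Seq \<sigma> \<leadsto> Seq \<sigma>) N) \<cdot> tailF \<sigma>) \<cdot> i)"

definition MemF :: "ty \<Rightarrow> tm \<Rightarrow> tm \<Rightarrow> fm" where
  "MemF \<sigma> z s = Exists N (Conj (LessF (Var 0) (lenT \<sigma> (lift 1 s)))
                                (Eql \<sigma> (lift 1 z) (nthT \<sigma> (lift 1 s) (Var 0))))"


section \<open>Derivability in P\<close>

text \<open>The axioms are stated for arbitrary terms over the context, which amounts to their universal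
  closures.\<close>

inductive EPA_axiom :: "ty list \<Rightarrow> fm \<Rightarrow> bool" for \<Gamma> where
  ax_refl: "has_ty \<Gamma> t \<sigma> \<Longrightarrow> EPA_axiom \<Gamma> (Eql \<sigma> t t)"
| ax_leibniz: "internal \<phi> \<Longrightarrow> wf_fm (\<sigma> # \<Gamma>) \<phi> \<Longrightarrow> has_ty \<Gamma> s \<sigma> \<Longrightarrow> has_ty \<Gamma> t \<sigma> \<Longrightarrow>
    EPA_axiom \<Gamma> (Imp (Eql \<sigma> s t) (Imp (inst s \<phi>) (inst t \<phi>)))"
| ax_ext: "has_ty \<Gamma> s (\<sigma> \<leadsto> \<tau>) \<Longrightarrow> has_ty \<Gamma> t (\<sigma> \<leadsto> \<tau>) \<Longrightarrow>
    EPA_axiom \<Gamma> (Imp (Forall \<sigma> (Eql \<tau> (lift 1 s \<cdot> Var 0) (lift 1 t \<cdot> Var 0)))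
                     (Eql (\<sigma> \<leadsto> \<tau>) s t))"
| ax_K: "has_ty \<Gamma> a \<sigma> \<Longrightarrow> has_ty \<Gamma> b \<tau> \<Longrightarrow>
    EPA_axiom \<Gamma> (Eql \<sigma> (Con (K \<sigma> \<tau>) \<cdot> a \<cdot> b) a)"
| ax_S: "has_ty \<Gamma> a (\<rho> \<leadsto> \<sigma> \<leadsto> \<tau>) \<Longrightarrow> has_ty \<Gamma> b (\<rho> \<leadsto> \<sigma>) \<Longrightarrow> has_ty \<Gamma> c \<rho> \<Longrightarrow>
    EPA_axiom \<Gamma> (Eql \<tau> (Con (S \<rho> \<sigma> \<tau>) \<cdot> a \<cdot> b \<cdot> c) (a \<cdot> c \<cdot> (b \<cdot> c)))"
| ax_Rec_zero: "has_ty \<Gamma> a \<rho> \<Longrightarrow> has_ty \<Gamma> f (N \<leadsto> \<rho> \<leadsto> \<rho>) \<Longrightarrow>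
    EPA_axiom \<Gamma> (Eql \<rho> (Con (Rec \<rho>) \<cdot> a \<cdot> f \<cdot> zero) a)"
| ax_Rec_suc: "has_ty \<Gamma> a \<rho> \<Longrightarrow> has_ty \<Gamma> f (N \<leadsto> \<rho> \<leadsto> \<rho>) \<Longrightarrow> has_ty \<Gamma> n N \<Longrightarrow>
    EPA_axiom \<Gamma> (Eql \<rho> (Con (Rec \<rho>) \<cdot> a \<cdot> f \<cdot> suc n) (f \<cdot> n \<cdot> (Con (Rec \<rho>) \<cdot> a \<cdot> f \<cdot> n)))"
| ax_LRec_nil: "has_ty \<Gamma> a \<rho> \<Longrightarrow> has_ty \<Gamma> f (\<sigma> \<leadsto> Seq \<sigma> \<leadsto> \<rho> \<leadsto> \<rho>) \<Longrightarrow>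
    EPA_axiom \<Gamma> (Eql \<rho> (Con (LRec \<sigma> \<rho>) \<cdot> a \<cdot> f \<cdot> Con (NilC \<sigma>)) a)"
| ax_LRec_cons: "has_ty \<Gamma> a \<rho> \<Longrightarrow> has_ty \<Gamma> f (\<sigma> \<leadsto> Seq \<sigma> \<leadsto> \<rho> \<leadsto> \<rho>) \<Longrightarrow>
    has_ty \<Gamma> x \<sigma> \<Longrightarrow> has_ty \<Gamma> s (Seq \<sigma>) \<Longrightarrow>
    EPA_axiom \<Gamma> (Eql \<rho> (Con (LRec \<sigma> \<rho>) \<cdot> a \<cdot> f \<cdot> (Con (ConsC \<sigma>) \<cdot> x \<cdot> s))
                       (f \<cdot> x \<cdot> s \<cdot> (Con (LRec \<sigma> \<rho>) \<cdot> a \<cdot> f \<cdot> s)))"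
| ax_seq_cases: "has_ty \<Gamma> s (Seq \<sigma>) \<Longrightarrow>
    EPA_axiom \<Gamma> (Disj (Eql (Seq \<sigma>) s (Con (NilC \<sigma>)))
       (Exists \<sigma> (Exists (Seq \<sigma>) (Eql (Seq \<sigma>) (lift 2 s) (Con (ConsC \<sigma>) \<cdot> Var 1 \<cdot> Var 0)))))"
| ax_suc_nonzero: "has_ty \<Gamma> n N \<Longrightarrow> EPA_axiom \<Gamma> (Neg (Eql N (suc n) zero))"
| ax_suc_inj: "has_ty \<Gamma> m N \<Longrightarrow> has_ty \<Gamma> n N \<Longrightarrow>
    EPA_axiom \<Gamma> (Imp (Eql N (suc m) (suc n)) (Eql N m n))"
| ax_induct: "internal \<phi> \<Longrightarrow> wf_fm (N # \<Gamma>) \<phi> \<Longrightarrow>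
    EPA_axiom \<Gamma> (Imp (Conj (inst zero \<phi>) (Forall N (Imp \<phi> (succ_inst \<phi>)))) (Forall N \<phi>))"

text \<open>In the idealisation axiom, \<open>\<phi>\<close> lives in the context \<open>z, y, \<Gamma>\<close>, in the choice axiom in the
  context \<open>y, x, \<Gamma>\<close>; the weakening makes room for the sequence \<open>x\<close> and the functional \<open>F\<close>,
  respectively.\<close>

inductive P_axiom :: "ty list \<Rightarrow> fm \<Rightarrow> bool" for \<Gamma> where
  ax_EPA: "EPA_axiom \<Gamma> \<phi> \<Longrightarrow> P_axiom \<Gamma> \<phi>"
| ax_st_eq: "has_ty \<Gamma> s \<sigma> \<Longrightarrow> has_ty \<Gamma> t \<sigma> \<Longrightarrow>
    P_axiom \<Gamma> (Imp (Conj (St \<sigma> s) (Eql \<sigma> s t)) (St \<sigma> t))"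
| ax_st_closed: "has_ty [] t \<sigma> \<Longrightarrow> P_axiom \<Gamma> (St \<sigma> t)"
| ax_st_app: "has_ty \<Gamma> f (\<sigma> \<leadsto> \<tau>) \<Longrightarrow> has_ty \<Gamma> t \<sigma> \<Longrightarrow>
    P_axiom \<Gamma> (Imp (Conj (St (\<sigma> \<leadsto> \<tau>) f) (St \<sigma> t)) (St \<tau> (f \<cdot> t)))"
| ax_ext_induct: "wf_fm (N # \<Gamma>) \<phi> \<Longrightarrow>
    P_axiom \<Gamma> (Imp (Conj (inst zero \<phi>) (AllSt N (Imp \<phi> (succ_inst \<phi>)))) (AllSt N \<phi>))"
| ax_idealisation: "internal \<phi> \<Longrightarrow> wf_fm (\<sigma> # \<tau> # \<Gamma>) \<phi> \<Longrightarrow>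
    P_axiom \<Gamma> (Imp
      (AllSt (Seq \<sigma>) (Exists \<tau> (Forall \<sigma> (Imp (MemF \<sigma> (Var 0) (Var 2)) (weaken2 \<phi>)))))
      (Exists \<tau> (AllSt \<sigma> \<phi>)))"
| ax_HAC_int: "internal \<phi> \<Longrightarrow> wf_fm (\<tau> # \<rho> # \<Gamma>) \<phi> \<Longrightarrow>
    P_axiom \<Gamma> (Imp
      (AllSt \<rho> (ExSt \<tau> \<phi>))
      (ExSt (\<rho> \<leadsto> Seq \<tau>)
        (AllSt \<rho> (Exists \<tau> (Conj (MemF \<tau> (Var 0) (Var 2 \<cdot> Var 1)) (weaken2 \<phi>))))))"

text \<open>Classical natural deduction: \<open>P_derives \<Gamma> \<Delta> \<phi>\<close> says that \<open>\<phi>\<close> follows in P from the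
  hypotheses \<open>\<Delta>\<close>, everything over the context \<open>\<Gamma>\<close>.\<close>

inductive P_derives :: "ty list \<Rightarrow> fm list \<Rightarrow> fm \<Rightarrow> bool" where
  axiomI: "P_axiom \<Gamma> \<phi> \<Longrightarrow> P_derives \<Gamma> \<Delta> \<phi>"
| hypI: "\<phi> \<in> set \<Delta> \<Longrightarrow> wf_fm \<Gamma> \<phi> \<Longrightarrow> P_derives \<Gamma> \<Delta> \<phi>"
| impI: "wf_fm \<Gamma> \<phi> \<Longrightarrow> P_derives \<Gamma> (\<phi> # \<Delta>) \<psi> \<Longrightarrow> P_derives \<Gamma> \<Delta> (Imp \<phi> \<psi>)"
| impE: "P_derives \<Gamma> \<Delta> (Imp \<phi> \<psi>) \<Longrightarrow> P_derives \<Gamma> \<Delta> \<phi> \<Longrightarrow> P_derives \<Gamma> \<Delta> \<psi>"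
| classical: "wf_fm \<Gamma> \<phi> \<Longrightarrow> P_derives \<Gamma> (Neg \<phi> # \<Delta>) Bot \<Longrightarrow> P_derives \<Gamma> \<Delta> \<phi>"
| allI: "P_derives (\<sigma> # \<Gamma>) (map flift \<Delta>) \<phi> \<Longrightarrow> P_derives \<Gamma> \<Delta> (Forall \<sigma> \<phi>)"
| allE: "P_derives \<Gamma> \<Delta> (Forall \<sigma> \<phi>) \<Longrightarrow> has_ty \<Gamma> t \<sigma> \<Longrightarrow> P_derives \<Gamma> \<Delta> (inst t \<phi>)"

text \<open>For a formula with free variables this is provability of its universal closure.\<close>

abbreviation P_proves :: "ty list \<Rightarrow> fm \<Rightarrow> bool" where
  "P_proves \<Gamma> \<phi> \<equiv> P_derives \<Gamma> [] \<phi>"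


section \<open>Real numbers and infinitesimals\<close>

text \<open>Every number \<open>q\<close> codes a rational: \<open>q\<close> is the Cantor pair
  \<open>(s + d)(s + d + 1)/2 + s\<close> of a unique \<open>s\<close> and \<open>d\<close>, and it codes \<open>(s/2)/(d + 1)\<close> for even \<open>s\<close>
  and \<open>-((s + 1)/2)/(d + 1)\<close> for odd \<open>s\<close>.  \<open>RatVal q p m d\<close> says that this rational is
  \<open>(p - m)/(d + 1)\<close> with \<open>d\<close> the coded component and \<open>p\<close> or \<open>m\<close> zero.\<close>

definition RatVal :: "tm \<Rightarrow> tm \<Rightarrow> tm \<Rightarrow> tm \<Rightarrow> fm" where
  "RatVal q p m d = Exists N
     (let s = Var 0; q = lift 1 q; p = lift 1 p; m = lift 1 m; d = lift 1 d in
      Conj (Eql N (timesT twoT q)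
                  (plusT (timesT (plusT s d) (suc (plusT s d))) (timesT twoT s)))
           (Disj (Conj (Eql N s (timesT twoT p)) (Eql N m zero))
                 (Conj (Eql N (suc s) (timesT twoT m)) (Eql N p zero))))"

text \<open>\<open>|q - r| < 1/2^n\<close> for rationals \<open>q\<close>, \<open>r\<close>, with denominators cleared.\<close>

definition RatDistLess :: "tm \<Rightarrow> tm \<Rightarrow> tm \<Rightarrow> fm" where
  "RatDistLess q r n = Exists N (Exists N (Exists N (Exists N (Exists N (Exists N
     (let p = Var 5; m = Var 4; d = Var 3; p' = Var 2; m' = Var 1; d' = Var 0;
          e = pow2T (lift 6 n);
          a = plusT (timesT p (suc d')) (timesT m' (suc d));
          b = plusT (timesT p' (suc d)) (timesT m (suc d'));
          c = timesT (suc d) (suc d') in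
      Conj (Conj (RatVal (lift 6 q) p m d) (RatVal (lift 6 r) p' m' d'))
           (Conj (LessF (timesT a e) (plusT (timesT b e) c))
                 (LessF (timesT b e) (plusT (timesT a e) c)))))))))"

abbreviation RealTy :: ty where "RealTy \<equiv> N \<leadsto> N"

text \<open>\<open>f\<close> represents a real: \<open>|f(n) - f(n + i)| < 1/2^n\<close> for all \<open>n\<close>, \<open>i\<close>.\<close>

definition IsReal :: "tm \<Rightarrow> fm" where
  "IsReal f = Forall N (Forall N
     (let n = Var 1; i = Var 0; f = lift 2 f in
      RatDistLess (f \<cdot> n) (f \<cdot> plusT n i) n))"

text \<open>\<open>|f| < 1/k\<close> for a real \<open>f\<close>.  As \<open>x < y\<close> for reals means \<open>x(n) + 2/2^n < y(n)\<close> for some \<open>n\<close>,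
  this is \<open>|f(n)| + 2/2^n < 1/k\<close> for some \<open>n\<close>; denominators are again cleared, and \<open>p + m\<close> is the
  numerator of \<open>|f(n)|\<close>.\<close>

definition AbsLessRecip :: "tm \<Rightarrow> tm \<Rightarrow> fm" where
  "AbsLessRecip f k = Exists N (Exists N (Exists N (Exists N
     (let n = Var 3; p = Var 2; m = Var 1; d = Var 0; f = lift 4 f; k = lift 4 k in
      Conj (RatVal (f \<cdot> n) p m d)
           (LessF (timesT (plusT (timesT (plusT p m) (pow2T n)) (timesT twoT (suc d))) k)
                  (timesT (suc d) (pow2T n)))))))"

definition Infinitesimal :: "tm \<Rightarrow> fm" where
  "Infinitesimal e = AllSt N (Imp (Neg (Eql N (Var 0) zero)) (AbsLessRecip (lift 1 e) (Var 0)))"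

definition AllReal :: "fm \<Rightarrow> fm" where
  "AllReal \<phi> = Forall RealTy (Imp (IsReal (Var 0)) \<phi>)"

definition AllInfinitesimal :: "fm \<Rightarrow> fm" where
  "AllInfinitesimal \<phi> = AllReal (Imp (Infinitesimal (Var 0)) \<phi>)"

end

theory Submission
  imports Defs
begin

text \<open>
  The negation of the left-hand side, for fixed standard \<open>x\<close>, asserts an \<open>\<epsilon>\<close> that is real, smaller
  than \<open>1/k\<close> for all standard \<open>k\<close>, and satisfies \<open>\<not> \<phi>(x, y, \<epsilon>)\<close> for all standard \<open>y\<close>.  A single
  standard quantifier over a sequence \<open>z\<close> of elements of \<open>\<tau>\<close> can replace those over \<open>k\<close> and \<open>y\<close>:
  read \<open>k\<close> off \<open>z\<close> as its length and \<open>y\<close> as its head.  Idealisation then yields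
  a standard sequence \<open>w\<close> such that no \<open>\<epsilon>\<close> survives all \<open>z \<in> w\<close>, and this is internal.  The
  converse holds because the entries of a standard sequence are standard.
\<close>

section \<open>Substitutions\<close>

text \<open>Every substitution occurring in the calculus has the form \<open>sb ts k\<close>, which replaces the first
  variables by \<open>ts\<close> and maps the following ones to \<open>Var k, Var (k + 1), \<dots>\<close>; this shape is closed
  under composition and under passing below a binder, so the simplifier can normalise.\<close>

definition sb :: "tm list \<Rightarrow> nat \<Rightarrow> nat \<Rightarrow> tm" where
  "sb ts k i = (if i < length ts then ts ! i else Var (i - length ts + k))"

lemma sb_simps [simp]:
  "sb [] k n = Var (n + k)"
  "sb (t # ts) k 0 = t"
  "sb (t # ts) k (Suc n) = sb ts k n"
  "sb (t # ts) k (numeral m) = sb ts k (pred_numeral m)"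
  by (auto simp: sb_def numeral_eq_Suc)

lemma lift_sb: "lift k = tsubst (sb [] k)"
  by (auto simp: lift_def fun_eq_iff intro!: arg_cong2[where f = tsubst])

lemma flift_sb: "flift = fsubst (sb [] (Suc 0))"
  by (auto simp: flift_def fun_eq_iff intro!: arg_cong2[where f = fsubst])

lemma inst_sb: "inst t = fsubst (sb [t] 0)"
  by (auto simp: inst_def sb_def fun_eq_iff split: nat.split intro!: arg_cong2[where f = fsubst])

lemma succ_inst_sb: "succ_inst = fsubst (sb [suc (Var 0)] (Suc 0))"
  by (auto simp: succ_inst_def sb_def fun_eq_iff split: nat.split intro!: arg_cong2[where f = fsubst])

lemma weaken2_sb: "weaken2 = fsubst (sb [Var 0, Var (Suc 0)] 3)"
  by (auto simp: weaken2_def sb_def fun_eq_iff nth_Cons split: nat.split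
      intro!: arg_cong2[where f = fsubst])

lemma up_sb [simp]: "up (sb ts k) = sb (Var 0 # map (tsubst (sb [] (Suc 0))) ts) (Suc k)"
  by (auto simp: up_def lift_sb sb_def fun_eq_iff split: nat.split)

section \<open>Composition of substitutions\<close>

lemma tsubst_tsubst: "tsubst f (tsubst g t) = tsubst (\<lambda>i. tsubst f (g i)) t"
  by (induction t) auto

text \<open>At index 0 both sides are \<open>Var 0\<close>. Elsewhere substituting after a lift and
  lifting after a substitution agree, because \<open>up f\<close> at a successor index is the lifted
  value of \<open>f\<close>. This is the binder case of the composition law for formulas.\<close>

lemma up_comp: "(\<lambda>i. tsubst (up f) (up g i)) = up (\<lambda>i. tsubst f (g i))"
  by (auto simp: fun_eq_iff up_def lift_def tsubst_tsubst split: nat.split)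

lemma fsubst_fsubst: "fsubst f (fsubst g \<phi>) = fsubst (\<lambda>i. tsubst f (g i)) \<phi>"
  by (induction \<phi> arbitrary: f g) (auto simp: tsubst_tsubst up_comp)

text \<open>An index past \<open>us\<close> is first shifted by \<open>j\<close>. Either it then
  hits an entry of \<open>ts\<close>, which accounts for \<open>drop j ts\<close>, or it passes
  \<open>ts\<close> and is shifted again. Truncated subtraction makes
  \<open>j - length ts + k\<close> right in both cases \<open>j \<le> length ts\<close> and
  \<open>j > length ts\<close>.\<close>

lemma sb_comp:
  "(\<lambda>i. tsubst (sb ts k) (sb us j i)) =
     sb (map (tsubst (sb ts k)) us @ drop j ts) (j - length ts + k)"
  by (auto simp: fun_eq_iff sb_def nth_append intro!: arg_cong2[where f = nth])

lemmas sb_sb [simp] = tsubst_tsubst[of "sb ts k" "sb us j" for ts k us j, unfolded sb_comp]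
  fsubst_fsubst[of "sb ts k" "sb us j" for ts k us j, unfolded sb_comp]

lemma tsubst_Var: "tsubst Var t = t"
  by (induction t) auto

lemma fsubst_Var: "fsubst Var \<phi> = \<phi>"
proof (induction \<phi>)
  case (Forall \<sigma> \<phi>)
  have "up Var = Var"
    by (auto simp: up_def lift_def fun_eq_iff split: nat.split)
  with Forall show ?case by simp
qed (auto simp: tsubst_Var)

text \<open>The representation by \<open>sb\<close> is not unique: the identity has one for every
  length of the list. These are the forms that arise when a lift meets an instantiation.\<close>

lemma sb_id [simp]:
  "sb [] 0 = Var"
  "sb [Var 0] (Suc 0) = Var"
  "sb [Var 0, Var (Suc 0)] 2 = Var"
  "sb [Var 0, Var (Suc 0), Var 2] 3 = Var"
  by (auto simp: sb_def fun_eq_iff nth_Cons split: nat.split)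

lemma sb_trim: "sb [Var k] (Suc k) = sb [] k" "sb [t, Var k] (Suc k) = sb [t] k"
  by (auto simp: sb_def fun_eq_iff nth_Cons split: nat.split)

declare tsubst_Var [simp] fsubst_Var [simp]

lemma Suc_Suc_0 [simp]: "Suc (Suc 0) = 2"
  by simp

lemma internal_fsubst [simp]: "internal (fsubst f \<phi>) = internal \<phi>"
  by (induction \<phi> arbitrary: f) auto

lemma fsubst_connectives [simp]:
  "fsubst f (Neg \<phi>) = Neg (fsubst f \<phi>)"
  "fsubst f (Conj \<phi> \<psi>) = Conj (fsubst f \<phi>) (fsubst f \<psi>)"
  "fsubst f (Disj \<phi> \<psi>) = Disj (fsubst f \<phi>) (fsubst f \<psi>)"
  "fsubst f (Exists \<sigma> \<phi>) = Exists \<sigma> (fsubst (up f) \<phi>)"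
  "fsubst f (AllSt \<sigma> \<phi>) = AllSt \<sigma> (fsubst (up f) \<phi>)"
  "fsubst f (ExSt \<sigma> \<phi>) = ExSt \<sigma> (fsubst (up f) \<phi>)"
  by (simp_all add: Neg_def Conj_def Disj_def Exists_def AllSt_def ExSt_def up_def)

lemma internal_connectives [simp]:
  "internal (Neg \<phi>) = internal \<phi>"
  "internal (Conj \<phi> \<psi>) = (internal \<phi> \<and> internal \<psi>)"
  "internal (Disj \<phi> \<psi>) = (internal \<phi> \<and> internal \<psi>)"
  "internal (Exists \<sigma> \<phi>) = internal \<phi>"
  by (simp_all add: Neg_def Conj_def Disj_def Exists_def)

section \<open>Typing\<close>

text \<open>A functional counterpart of \<open>has_ty\<close>, which turns typing side conditions
  into equations that the simplifier evaluates.\<close>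

fun tyof :: "ty list \<Rightarrow> tm \<Rightarrow> ty option" where
  "tyof \<Gamma> (Var n) = (if n < length \<Gamma> then Some (\<Gamma> ! n) else None)"
| "tyof \<Gamma> (Con c) = Some (cst_ty c)"
| "tyof \<Gamma> (s \<cdot> t) = (case tyof \<Gamma> s of
     Some (\<sigma> \<leadsto> \<tau>) \<Rightarrow> if tyof \<Gamma> t = Some \<sigma> then Some \<tau> else None | _ \<Rightarrow> None)"

lemma has_ty_iff: "has_ty \<Gamma> t \<sigma> \<longleftrightarrow> tyof \<Gamma> t = Some \<sigma>"
proof
  show "has_ty \<Gamma> t \<sigma> \<Longrightarrow> tyof \<Gamma> t = Some \<sigma>"
    by (induction rule: has_ty.induct) auto
  show "tyof \<Gamma> t = Some \<sigma> \<Longrightarrow> has_ty \<Gamma> t \<sigma>"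
    by (induction t arbitrary: \<sigma>)
      (auto intro: has_ty.intros split: if_splits option.splits ty.splits)
qed

lemma wf_connectives [simp]:
  "wf_fm \<Gamma> (Neg \<phi>) = wf_fm \<Gamma> \<phi>"
  "wf_fm \<Gamma> (Conj \<phi> \<psi>) = (wf_fm \<Gamma> \<phi> \<and> wf_fm \<Gamma> \<psi>)"
  "wf_fm \<Gamma> (Disj \<phi> \<psi>) = (wf_fm \<Gamma> \<phi> \<and> wf_fm \<Gamma> \<psi>)"
  "wf_fm \<Gamma> (Exists \<sigma> \<phi>) = wf_fm (\<sigma> # \<Gamma>) \<phi>"
  "wf_fm \<Gamma> (AllSt \<sigma> \<phi>) = wf_fm (\<sigma> # \<Gamma>) \<phi>"
  "wf_fm \<Gamma> (ExSt \<sigma> \<phi>) = wf_fm (\<sigma> # \<Gamma>) \<phi>"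
  by (auto simp: Neg_def Conj_def Disj_def Exists_def AllSt_def ExSt_def has_ty_iff)

lemma tyof_tsubst:
  assumes "\<And>i. i < length \<Gamma> \<Longrightarrow> tyof \<Gamma>' (f i) = Some (\<Gamma> ! i)"
  shows "tyof \<Gamma> t = Some \<sigma> \<Longrightarrow> tyof \<Gamma>' (tsubst f t) = Some \<sigma>"
  by (induction t arbitrary: \<sigma>) (auto simp: assms split: if_splits option.splits ty.splits)

lemma wf_fsubst:
  assumes "wf_fm \<Gamma> \<phi>" and "\<And>i. i < length \<Gamma> \<Longrightarrow> tyof \<Gamma>' (f i) = Some (\<Gamma> ! i)"
  shows "wf_fm \<Gamma>' (fsubst f \<phi>)"
  using assms
proof (induction \<phi> arbitrary: \<Gamma> \<Gamma>' f)
  case (Forall \<sigma> \<phi>)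
  have "tyof (\<sigma> # \<Gamma>') (up f i) = Some ((\<sigma> # \<Gamma>) ! i)" if "i < length (\<sigma> # \<Gamma>)" for i
    using that Forall.prems(2)
    by (cases i) (auto simp: up_def lift_def intro!: tyof_tsubst[of \<Gamma>'])
  with Forall.prems(1) show ?case using Forall.IH[of "\<sigma> # \<Gamma>" "\<sigma> # \<Gamma>'" "up f"] by simp
qed (auto simp: has_ty_iff intro: tyof_tsubst)

text \<open>The condition on \<open>drop\<close> says that the remaining variables keep their types
  under the shift. For contexts with explicit first entries and a common unknown tail it is decided
  by rewriting.\<close>

lemma tyof_sb:
  assumes "list_all2 (\<lambda>t \<sigma>. tyof \<Gamma>' t = Some \<sigma>) ts (take (length ts) \<Gamma>)"
    and "drop k \<Gamma>' = drop (length ts) \<Gamma>" and "i < length \<Gamma>"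
  shows "tyof \<Gamma>' (sb ts k i) = Some (\<Gamma> ! i)"
proof (cases "i < length ts")
  case True
  with assms(1) show ?thesis by (auto simp: sb_def list_all2_conv_all_nth)
next
  case False
  let ?j = "i - length ts"
  from False assms(3) have "?j < length (drop (length ts) \<Gamma>)" by simp
  then have j: "?j < length (drop k \<Gamma>')" by (simp only: assms(2))
  have "\<Gamma> ! i = drop (length ts) \<Gamma> ! ?j" using False assms(3) by simp
  also have "\<dots> = \<Gamma>' ! (k + ?j)" using j by (simp flip: assms(2))
  finally show ?thesis using False j by (simp add: sb_def add.commute)
qed

lemma wf_fsubst_sb:
  assumes "wf_fm \<Gamma> \<phi>" "list_all2 (\<lambda>t \<sigma>. tyof \<Gamma>' t = Some \<sigma>) ts (take (length ts) \<Gamma>)"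
    and "drop k \<Gamma>' = drop (length ts) \<Gamma>"
  shows "wf_fm \<Gamma>' (fsubst (sb ts k) \<phi>)"
  using wf_fsubst[OF assms(1)] tyof_sb[OF assms(2,3)] by blast

lemma tyof_tsubst_sb:
  assumes "tyof \<Gamma> t = Some \<sigma>" "list_all2 (\<lambda>t \<sigma>. tyof \<Gamma>' t = Some \<sigma>) ts (take (length ts) \<Gamma>)"
    and "drop k \<Gamma>' = drop (length ts) \<Gamma>"
  shows "tyof \<Gamma>' (tsubst (sb ts k) t) = Some \<sigma>"
  using tyof_tsubst[OF _ assms(1)] tyof_sb[OF assms(2,3)] by blast

lemma tyof_lift [simp]:
  "tyof \<Gamma> t = Some \<sigma> \<Longrightarrow> tyof (\<rho> # \<Gamma>) (tsubst (sb [] (Suc 0)) t) = Some \<sigma>"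
  "tyof \<Gamma> t = Some \<sigma> \<Longrightarrow> tyof (\<rho> # \<rho>' # \<Gamma>) (tsubst (sb [] 2) t) = Some \<sigma>"
  by (rule tyof_tsubst_sb; simp)+

lemma wf_lift [simp]: "wf_fm \<Gamma> \<phi> \<Longrightarrow> wf_fm (\<rho> # \<Gamma>) (flift \<phi>)"
  unfolding flift_sb by (rule wf_fsubst_sb) auto

lemma wf_inst: "wf_fm (\<sigma> # \<Gamma>) \<phi> \<Longrightarrow> tyof \<Gamma> t = Some \<sigma> \<Longrightarrow> wf_fm \<Gamma> (fsubst (sb [t] 0) \<phi>)"
  by (rule wf_fsubst_sb) auto

lemma tsubst_zeroT [simp]: "tsubst f (zeroT \<sigma>) = zeroT \<sigma>"
  by (induction \<sigma>) auto

lemma tyof_zeroT [simp]: "tyof \<Gamma> (zeroT \<sigma>) = Some \<sigma>"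
  by (induction \<sigma>) auto

lemma tsubst_terms [simp]:
  "tsubst f (headF \<sigma>) = headF \<sigma>"
  "tsubst f (tailF \<sigma>) = tailF \<sigma>"
  "tsubst f (lenT \<sigma> s) = lenT \<sigma> (tsubst f s)"
  "tsubst f (plusT m n) = plusT (tsubst f m) (tsubst f n)"
  "tsubst f (nthT \<sigma> s m) = nthT \<sigma> (tsubst f s) (tsubst f m)"
  by (simp_all add: headF_def tailF_def lenT_def plusT_def plusF_def nthT_def)

lemma tyof_headF [simp]: "tyof \<Gamma> (headF \<sigma>) = Some (Seq \<sigma> \<leadsto> \<sigma>)"
  by (simp add: headF_def)

lemma tyof_tailF [simp]: "tyof \<Gamma> (tailF \<sigma>) = Some (Seq \<sigma> \<leadsto> Seq \<sigma>)"
  by (simp add: tailF_def)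

lemma tyof_terms [simp]:
  "tyof \<Gamma> s = Some (Seq \<sigma>) \<Longrightarrow> tyof \<Gamma> (lenT \<sigma> s) = Some N"
  "tyof \<Gamma> m = Some N \<Longrightarrow> tyof \<Gamma> n = Some N \<Longrightarrow> tyof \<Gamma> (plusT m n) = Some N"
  "tyof \<Gamma> s = Some (Seq \<sigma>) \<Longrightarrow> tyof \<Gamma> m = Some N \<Longrightarrow> tyof \<Gamma> (nthT \<sigma> s m) = Some \<sigma>"
  by (simp_all add: lenT_def plusT_def plusF_def nthT_def)

lemma fsubst_LessF [simp]:
  "fsubst (sb ts k) (LessF m n) = LessF (tsubst (sb ts k) m) (tsubst (sb ts k) n)"
  by (simp add: LessF_def lift_sb)

lemma fsubst_MemF [simp]:
  "fsubst (sb ts k) (MemF \<sigma> z s) = MemF \<sigma> (tsubst (sb ts k) z) (tsubst (sb ts k) s)"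
  by (simp add: MemF_def lift_sb)

lemma internal_LessF [simp]: "internal (LessF m n)"
  by (simp add: LessF_def)

lemma internal_MemF [simp]: "internal (MemF \<sigma> z s)"
  by (simp add: MemF_def)

lemma wf_LessF [simp]: "tyof \<Gamma> m = Some N \<Longrightarrow> tyof \<Gamma> n = Some N \<Longrightarrow> wf_fm \<Gamma> (LessF m n)"
  by (simp add: LessF_def lift_sb has_ty_iff)

lemma wf_MemF [simp]:
  "tyof \<Gamma> z = Some \<sigma> \<Longrightarrow> tyof \<Gamma> s = Some (Seq \<sigma>) \<Longrightarrow> wf_fm \<Gamma> (MemF \<sigma> z s)"
  by (simp add: MemF_def lift_sb has_ty_iff)

section \<open>Well-formedness of axioms and derivable formulas\<close>

lemmas sbs = lift_sb flift_sb inst_sb succ_inst_sb weaken2_sb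

lemma wf_EPA_axiom: "EPA_axiom \<Gamma> \<phi> \<Longrightarrow> wf_fm \<Gamma> \<phi>"
  by (induction rule: EPA_axiom.induct)
    (auto simp: sbs has_ty_iff intro!: wf_inst elim!: wf_fsubst_sb)

lemma wf_P_axiom: "P_axiom \<Gamma> \<phi> \<Longrightarrow> wf_fm \<Gamma> \<phi>"
proof (induction rule: P_axiom.induct)
  case (ax_st_closed t \<sigma>)
  \<comment> \<open>The identity substitution carries a term from the empty context to any other,
    since there is no variable whose type could change.\<close>
  have "tyof \<Gamma> (tsubst Var t) = Some \<sigma>"
    using ax_st_closed by (intro tyof_tsubst[of "[]"]) (auto simp: has_ty_iff)
  then show ?case by (simp add: has_ty_iff)
qed (auto simp: sbs has_ty_iff wf_EPA_axiom intro!: wf_inst elim!: wf_fsubst_sb)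

text \<open>Supplies the well-formedness side conditions of the derived rules from derivations
  already at hand.\<close>

lemma wf_P_derives: "P_derives \<Gamma> \<Delta> \<phi> \<Longrightarrow> wf_fm \<Gamma> \<phi>"
  by (induction rule: P_derives.induct)
   (auto simp: wf_P_axiom inst_sb has_ty_iff intro!: wf_inst)

section \<open>Derived rules\<close>

declare sbs [simp]

text \<open>Hypothesis lists are compared as sets, so exchange and contraction are included.\<close>

lemma weaken: "P_derives \<Gamma> \<Delta> \<phi> \<Longrightarrow> set \<Delta> \<subseteq> set \<Delta>' \<Longrightarrow> P_derives \<Gamma> \<Delta>' \<phi>"
proof (induction arbitrary: \<Delta>' rule: P_derives.induct)
  case (impI \<Gamma> \<phi> \<Delta> \<psi>)
  from impI.hyps(1) show ?case
    by (rule P_derives.impI) (use impI.prems in \<open>auto intro!: impI.IH\<close>)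
next
  case (classical \<Gamma> \<phi> \<Delta>)
  from classical.hyps(1) show ?case
    by (rule P_derives.classical) (use classical.prems in \<open>auto intro!: classical.IH\<close>)
next
  case (allI \<sigma> \<Gamma> \<Delta> \<phi>)
  show ?case
    by (rule P_derives.allI) (use allI.prems in \<open>fastforce intro!: allI.IH\<close>)
next
  case (allE \<Gamma> \<Delta> \<sigma> \<phi> t)
  then show ?case using P_derives.allE by blast
qed (auto intro: P_derives.intros)

lemma weaken1: "P_derives \<Gamma> \<Delta> \<phi> \<Longrightarrow> P_derives \<Gamma> (\<psi> # \<Delta>) \<phi>"
  by (erule weaken) auto

section \<open>Propositional rules\<close>

lemma BotE: "P_derives \<Gamma> \<Delta> Bot \<Longrightarrow> wf_fm \<Gamma> \<phi> \<Longrightarrow> P_derives \<Gamma> \<Delta> \<phi>"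
  by (rule classical) (auto intro: weaken1)

lemma NegI: "wf_fm \<Gamma> \<phi> \<Longrightarrow> P_derives \<Gamma> (\<phi> # \<Delta>) Bot \<Longrightarrow> P_derives \<Gamma> \<Delta> (Neg \<phi>)"
  unfolding Neg_def by (rule impI)

lemma NegE: "P_derives \<Gamma> \<Delta> (Neg \<phi>) \<Longrightarrow> P_derives \<Gamma> \<Delta> \<phi> \<Longrightarrow> P_derives \<Gamma> \<Delta> Bot"
  unfolding Neg_def by (rule impE)

lemma Neg_NegD: "P_derives \<Gamma> \<Delta> (Neg (Neg \<phi>)) \<Longrightarrow> P_derives \<Gamma> \<Delta> \<phi>"
  using wf_P_derives[of \<Gamma> \<Delta> "Neg (Neg \<phi>)"]
  by (auto intro!: classical[of \<Gamma> \<phi>] NegE[OF weaken1 hypI])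

lemma ConjI:
  assumes "P_derives \<Gamma> \<Delta> \<phi>" "P_derives \<Gamma> \<Delta> \<psi>"
  shows "P_derives \<Gamma> \<Delta> (Conj \<phi> \<psi>)"
proof -
  let ?\<Delta> = "Imp \<phi> (Neg \<psi>) # \<Delta>"
  have "P_derives \<Gamma> ?\<Delta> (Imp \<phi> (Neg \<psi>))"
    using assms by (intro hypI) (auto dest: wf_P_derives)
  moreover have "P_derives \<Gamma> ?\<Delta> \<phi>" "P_derives \<Gamma> ?\<Delta> \<psi>"
    using assms by (auto intro: weaken1)
  ultimately have "P_derives \<Gamma> ?\<Delta> Bot"
    by (intro NegE[OF impE])
  then show ?thesis
    unfolding Conj_def using assms by (intro NegI) (auto dest: wf_P_derives)
qed

lemma ConjD1:
  assumes "P_derives \<Gamma> \<Delta> (Conj \<phi> \<psi>)"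
  shows "P_derives \<Gamma> \<Delta> \<phi>"
proof -
  have wf: "wf_fm \<Gamma> \<phi>" "wf_fm \<Gamma> \<psi>" using wf_P_derives[OF assms] by auto
  \<comment> \<open>Ex falso makes \<open>Neg \<phi>\<close> yield
    \<open>Imp \<phi> (Neg \<psi>)\<close>, exactly what the encoded conjunction denies.\<close>
  have "P_derives \<Gamma> (\<phi> # Neg \<phi> # \<Delta>) Bot"
    using wf by (intro NegE[of _ _ \<phi>] hypI) auto
  then have "P_derives \<Gamma> (Neg \<phi> # \<Delta>) (Imp \<phi> (Neg \<psi>))"
    using wf by (auto intro!: impI[OF _ BotE])
  moreover have "P_derives \<Gamma> (Neg \<phi> # \<Delta>) (Neg (Imp \<phi> (Neg \<psi>)))"
    using assms unfolding Conj_def by (auto intro: weaken1)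
  ultimately show ?thesis by - (rule classical[OF wf(1) NegE])
qed

lemma ConjD2:
  assumes "P_derives \<Gamma> \<Delta> (Conj \<phi> \<psi>)"
  shows "P_derives \<Gamma> \<Delta> \<psi>"
proof -
  have wf: "wf_fm \<Gamma> \<phi>" "wf_fm \<Gamma> \<psi>" using wf_P_derives[OF assms] by auto
  have "P_derives \<Gamma> (Neg \<psi> # \<Delta>) (Imp \<phi> (Neg \<psi>))"
    using wf by (intro impI hypI) auto
  moreover have "P_derives \<Gamma> (Neg \<psi> # \<Delta>) (Neg (Imp \<phi> (Neg \<psi>)))"
    using assms unfolding Conj_def by (auto intro: weaken1)
  ultimately show ?thesis by - (rule classical[OF wf(2) NegE])
qed

lemma IffI:
  "P_derives \<Gamma> (\<phi> # \<Delta>) \<psi> \<Longrightarrow> P_derives \<Gamma> (\<psi> # \<Delta>) \<phi> \<Longrightarrow> P_derives \<Gamma> \<Delta> (Iff \<phi> \<psi>)"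
  unfolding Iff_def by (intro ConjI impI) (auto dest: wf_P_derives)

lemma DisjE:
  assumes "P_derives \<Gamma> \<Delta> (Disj \<phi> \<psi>)"
    and "P_derives \<Gamma> (\<phi> # \<Delta>) \<chi>" "P_derives \<Gamma> (\<psi> # \<Delta>) \<chi>"
  shows "P_derives \<Gamma> \<Delta> \<chi>"
proof -
  have wf: "wf_fm \<Gamma> \<phi>" "wf_fm \<Gamma> \<psi>" "wf_fm \<Gamma> \<chi>"
    using wf_P_derives[OF assms(1)] wf_P_derives[OF assms(2)] by auto
  let ?\<Delta> = "Neg \<chi> # \<Delta>"
  have nc: "P_derives \<Gamma> \<Theta> (Neg \<chi>)" if "Neg \<chi> \<in> set \<Theta>" for \<Theta>
    using that wf by (intro hypI) auto
  have "P_derives \<Gamma> (\<phi> # ?\<Delta>) \<chi>" "P_derives \<Gamma> (\<psi> # ?\<Delta>) \<chi>"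
    by (rule weaken[OF assms(2)], auto) (rule weaken[OF assms(3)], auto)
  then have n: "P_derives \<Gamma> ?\<Delta> (Neg \<phi>)" "P_derives \<Gamma> ?\<Delta> (Neg \<psi>)"
    using wf by (auto intro!: NegI NegE[OF nc])
  have "P_derives \<Gamma> ?\<Delta> (Imp (Neg \<phi>) \<psi>)"
    using assms(1) unfolding Disj_def by (auto intro: weaken1)
  then have "P_derives \<Gamma> ?\<Delta> Bot"
    using n by (intro NegE[OF n(2) impE])
  then show ?thesis by (rule classical[OF wf(3)])
qed

lemma DisjI1:
  assumes "P_derives \<Gamma> \<Delta> \<phi>" "wf_fm \<Gamma> \<psi>"
  shows "P_derives \<Gamma> \<Delta> (Disj \<phi> \<psi>)"
  unfolding Disj_def
proof (rule impI[OF _ BotE])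
  show "P_derives \<Gamma> (Neg \<phi> # \<Delta>) Bot"
    using assms wf_P_derives[OF assms(1)]
    by (intro NegE[OF hypI weaken1]) auto
qed (use assms in \<open>auto dest: wf_P_derives\<close>)

lemma DisjI2:
  "P_derives \<Gamma> \<Delta> \<psi> \<Longrightarrow> wf_fm \<Gamma> \<phi> \<Longrightarrow> P_derives \<Gamma> \<Delta> (Disj \<phi> \<psi>)"
  unfolding Disj_def by (intro impI) (auto intro: weaken1)

section \<open>Quantifier rules\<close>

lemma ForallE:
  "P_derives \<Gamma> \<Delta> (Forall \<sigma> \<phi>) \<Longrightarrow> tyof \<Gamma> t = Some \<sigma> \<Longrightarrow> P_derives \<Gamma> \<Delta> (fsubst (sb [t] 0) \<phi>)"
  using allE by (simp add: has_ty_iff)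

lemma ExistsI:
  assumes "P_derives \<Gamma> \<Delta> (fsubst (sb [t] 0) \<phi>)" "wf_fm (\<sigma> # \<Gamma>) \<phi>" "tyof \<Gamma> t = Some \<sigma>"
  shows "P_derives \<Gamma> \<Delta> (Exists \<sigma> \<phi>)"
  unfolding Exists_def
proof (rule NegI)
  let ?\<Delta> = "Forall \<sigma> (Neg \<phi>) # \<Delta>"
  have "P_derives \<Gamma> ?\<Delta> (Forall \<sigma> (Neg \<phi>))"
    using assms by (intro hypI) auto
  from ForallE[OF this assms(3)] have "P_derives \<Gamma> ?\<Delta> (Neg (fsubst (sb [t] 0) \<phi>))"
    by simp
  then show "P_derives \<Gamma> ?\<Delta> Bot"
    using assms(1) by (intro NegE[OF _ weaken1])
qed (use assms in auto)

text \<open>The eigenvariable condition is expressed by \<open>flift\<close>: neither the old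
  hypotheses nor \<open>\<psi>\<close> can mention the new variable 0.\<close>

lemma ExistsE:
  assumes "P_derives \<Gamma> \<Delta> (Exists \<sigma> \<phi>)"
    and "P_derives (\<sigma> # \<Gamma>) (\<phi> # map flift \<Delta>) (flift \<psi>)" and "wf_fm \<Gamma> \<psi>"
  shows "P_derives \<Gamma> \<Delta> \<psi>"
proof -
  have wf: "wf_fm (\<sigma> # \<Gamma>) \<phi>" using wf_P_derives[OF assms(1)] by simp
  let ?\<Delta> = "Neg \<psi> # \<Delta>"
  have wf2: "wf_fm (\<sigma> # \<Gamma>) (flift \<psi>)" using assms(3) by (rule wf_lift)
  have "P_derives (\<sigma> # \<Gamma>) (\<phi> # map flift ?\<Delta>) (Neg (flift \<psi>))"
    using wf2 by (intro hypI) auto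
  moreover have "P_derives (\<sigma> # \<Gamma>) (\<phi> # map flift ?\<Delta>) (flift \<psi>)"
    using assms(2) by (rule weaken) auto
  ultimately have "P_derives (\<sigma> # \<Gamma>) (\<phi> # map flift ?\<Delta>) Bot"
    by (rule NegE)
  then have "P_derives \<Gamma> ?\<Delta> (Forall \<sigma> (Neg \<phi>))"
    using wf by (intro allI NegI)
  moreover have "P_derives \<Gamma> ?\<Delta> (Neg (Forall \<sigma> (Neg \<phi>)))"
    using assms(1) unfolding Exists_def by (auto intro: weaken1)
  ultimately show ?thesis by - (rule classical[OF assms(3) NegE])
qed

lemma AllStI:
  "P_derives (\<sigma> # \<Gamma>) (St \<sigma> (Var 0) # map flift \<Delta>) \<phi> \<Longrightarrow> P_derives \<Gamma> \<Delta> (AllSt \<sigma> \<phi>)"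
  unfolding AllSt_def by (intro allI impI) (auto simp: has_ty_iff)

lemma AllStE:
  assumes "P_derives \<Gamma> \<Delta> (AllSt \<sigma> \<phi>)" "P_derives \<Gamma> \<Delta> (St \<sigma> t)"
  shows "P_derives \<Gamma> \<Delta> (fsubst (sb [t] 0) \<phi>)"
proof -
  have "tyof \<Gamma> t = Some \<sigma>" using wf_P_derives[OF assms(2)] by (simp add: has_ty_iff)
  from ForallE[OF assms(1)[unfolded AllSt_def] this] assms(2) show ?thesis
    by (auto elim: impE)
qed

lemma ExStI:
  assumes "P_derives \<Gamma> \<Delta> (fsubst (sb [t] 0) \<phi>)" "P_derives \<Gamma> \<Delta> (St \<sigma> t)" "wf_fm (\<sigma> # \<Gamma>) \<phi>"
  shows "P_derives \<Gamma> \<Delta> (ExSt \<sigma> \<phi>)"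
proof -
  have "tyof \<Gamma> t = Some \<sigma>" using wf_P_derives[OF assms(2)] by (simp add: has_ty_iff)
  with assms show ?thesis unfolding ExSt_def
    by (intro ExistsI[of _ _ t]) (auto intro!: ConjI simp: has_ty_iff)
qed

lemma ExStE:
  assumes "P_derives \<Gamma> \<Delta> (ExSt \<sigma> \<phi>)"
    and "P_derives (\<sigma> # \<Gamma>) (\<phi> # St \<sigma> (Var 0) # map flift \<Delta>) (flift \<psi>)" and "wf_fm \<Gamma> \<psi>"
  shows "P_derives \<Gamma> \<Delta> \<psi>"
proof (rule ExistsE[OF assms(1)[unfolded ExSt_def] _ assms(3)])
  let ?C = "Conj (St \<sigma> (Var 0)) \<phi>"
  let ?\<Delta> = "?C # map flift \<Delta>"
  have "wf_fm (\<sigma> # \<Gamma>) \<phi>" using wf_P_derives[OF assms(1)] by simp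
  then have C: "P_derives (\<sigma> # \<Gamma>) ?\<Delta> ?C" by (intro hypI) (auto simp: has_ty_iff)
  have "P_derives (\<sigma> # \<Gamma>) (\<phi> # St \<sigma> (Var 0) # ?\<Delta>) (flift \<psi>)"
    using assms(2) by (rule weaken) auto
  then have "P_derives (\<sigma> # \<Gamma>) ?\<Delta> (Imp (St \<sigma> (Var 0)) (Imp \<phi> (flift \<psi>)))"
    using wf_P_derives[OF C] by (intro impI) auto
  then show "P_derives (\<sigma> # \<Gamma>) ?\<Delta> (flift \<psi>)"
    by (rule impE[OF impE[OF _ ConjD1[OF C]] ConjD2[OF C]])
qed

lemma forall_mono:
  assumes "P_derives \<Gamma> \<Delta> (Forall \<sigma> \<phi>)" "P_derives (\<sigma> # \<Gamma>) (\<phi> # map flift \<Delta>) \<psi>"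
  shows "P_derives \<Gamma> \<Delta> (Forall \<sigma> \<psi>)"
proof (rule impE[OF impI assms(1)])
  show wf: "wf_fm \<Gamma> (Forall \<sigma> \<phi>)" by (rule wf_P_derives[OF assms(1)])
  let ?\<Delta> = "map flift (Forall \<sigma> \<phi> # \<Delta>)"
  have "P_derives (\<sigma> # \<Gamma>) ?\<Delta> (flift (Forall \<sigma> \<phi>))"
    using wf_lift[OF wf] by (intro hypI) auto
  \<comment> \<open>Lifting below the binder and then instantiating with the fresh variable compose
    to the identity.\<close>
  from ForallE[OF this[simplified], of "Var 0"] have "P_derives (\<sigma> # \<Gamma>) ?\<Delta> \<phi>"
    by simp
  moreover have "P_derives (\<sigma> # \<Gamma>) ?\<Delta> (Imp \<phi> \<psi>)"
    using wf by (intro impI weaken[OF assms(2)]) auto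
  ultimately show "P_derives \<Gamma> (Forall \<sigma> \<phi> # \<Delta>) (Forall \<sigma> \<psi>)"
    by (intro allI) (rule impE)
qed

text \<open>Classical duality of the quantifiers over standard objects: a double negation is removed
  and the rest is argued pointwise. It turns the failure of the normal form at a given
  \<open>x\<close> into the premise of idealisation.\<close>

lemma not_ExSt_not:
  assumes "P_derives \<Gamma> \<Delta> (Neg (ExSt \<sigma> (Neg \<phi>)))"
  shows "P_derives \<Gamma> \<Delta> (AllSt \<sigma> \<phi>)"
  unfolding AllSt_def
proof (rule forall_mono)
  let ?\<psi> = "Neg (Conj (St \<sigma> (Var 0)) (Neg \<phi>))"
  have wf: "wf_fm (\<sigma> # \<Gamma>) \<phi>" using wf_P_derives[OF assms] by simp
  show "P_derives \<Gamma> \<Delta> (Forall \<sigma> ?\<psi>)"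
    using assms unfolding ExSt_def Exists_def by (rule Neg_NegD)
  show "P_derives (\<sigma> # \<Gamma>) (?\<psi> # map flift \<Delta>) (Imp (St \<sigma> (Var 0)) \<phi>)"
    by (rule impI[OF _ classical[OF _ NegE[of _ _ "Conj (St \<sigma> (Var 0)) (Neg \<phi>)", OF hypI ConjI[OF hypI hypI]]]])
      (use wf in \<open>auto simp: has_ty_iff\<close>)
qed

section \<open>Equality\<close>

lemma EPA: "EPA_axiom \<Gamma> \<phi> \<Longrightarrow> P_derives \<Gamma> \<Delta> \<phi>"
  by (intro axiomI ax_EPA)

text \<open>The replacement axiom covers internal formulas; standardness is transported along
  equations by \<open>St_eq\<close>.\<close>

lemma leibniz:
  assumes "P_derives \<Gamma> \<Delta> (Eql \<sigma> s t)" "P_derives \<Gamma> \<Delta> (fsubst (sb [s] 0) \<phi>)"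
    and "internal \<phi>" "wf_fm (\<sigma> # \<Gamma>) \<phi>"
  shows "P_derives \<Gamma> \<Delta> (fsubst (sb [t] 0) \<phi>)"
proof -
  have "P_derives \<Gamma> \<Delta> (Imp (Eql \<sigma> s t) (Imp (inst s \<phi>) (inst t \<phi>)))"
    using assms wf_P_derives[OF assms(1)] by (intro EPA ax_leibniz) auto
  then show ?thesis using impE[OF impE[OF _ assms(1)]] assms(2) by auto
qed

lemma eq_refl: "tyof \<Gamma> t = Some \<sigma> \<Longrightarrow> P_derives \<Gamma> \<Delta> (Eql \<sigma> t t)"
  by (intro EPA ax_refl) (simp add: has_ty_iff)

lemma eq_ty:
  assumes "P_derives \<Gamma> \<Delta> (Eql \<sigma> s t)"
  shows "tyof \<Gamma> s = Some \<sigma>" "tyof \<Gamma> t = Some \<sigma>"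
  using wf_P_derives[OF assms] by (auto simp: has_ty_iff)

text \<open>As in the next three lemmas, \<open>leibniz\<close> is applied to a template whose hole
  is \<open>Var 0\<close>; the terms that stay fixed are lifted past the hole.\<close>

lemma eq_sym: "P_derives \<Gamma> \<Delta> (Eql \<sigma> s t) \<Longrightarrow> P_derives \<Gamma> \<Delta> (Eql \<sigma> t s)"
  using leibniz[of \<Gamma> \<Delta> \<sigma> s t "Eql \<sigma> (Var 0) (lift 1 s)"]
  by (simp add: has_ty_iff eq_ty eq_refl)

lemma eq_trans:
  "P_derives \<Gamma> \<Delta> (Eql \<sigma> r s) \<Longrightarrow> P_derives \<Gamma> \<Delta> (Eql \<sigma> s t) \<Longrightarrow> P_derives \<Gamma> \<Delta> (Eql \<sigma> r t)"
  using leibniz[of \<Gamma> \<Delta> \<sigma> s t "Eql \<sigma> (lift 1 r) (Var 0)"]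
  by (simp add: has_ty_iff eq_ty)

lemma eq_app1:
  "P_derives \<Gamma> \<Delta> (Eql (\<sigma> \<leadsto> \<tau>) f g) \<Longrightarrow> tyof \<Gamma> t = Some \<sigma> \<Longrightarrow> P_derives \<Gamma> \<Delta> (Eql \<tau> (f \<cdot> t) (g \<cdot> t))"
  using leibniz[of \<Gamma> \<Delta> "\<sigma> \<leadsto> \<tau>" f g "Eql \<tau> (lift 1 (f \<cdot> t)) (Var 0 \<cdot> lift 1 t)"]
  by (simp add: has_ty_iff eq_ty eq_refl)

lemma eq_app2:
  "P_derives \<Gamma> \<Delta> (Eql \<sigma> s t) \<Longrightarrow> tyof \<Gamma> f = Some (\<sigma> \<leadsto> \<tau>) \<Longrightarrow> P_derives \<Gamma> \<Delta> (Eql \<tau> (f \<cdot> s) (f \<cdot> t))"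
  using leibniz[of \<Gamma> \<Delta> \<sigma> s t "Eql \<tau> (lift 1 (f \<cdot> s)) (lift 1 f \<cdot> Var 0)"]
  by (simp add: has_ty_iff eq_ty eq_refl)

lemma St_eq:
  assumes "P_derives \<Gamma> \<Delta> (Eql \<sigma> s t)" "P_derives \<Gamma> \<Delta> (St \<sigma> s)"
  shows "P_derives \<Gamma> \<Delta> (St \<sigma> t)"
proof -
  have "P_derives \<Gamma> \<Delta> (Imp (Conj (St \<sigma> s) (Eql \<sigma> s t)) (St \<sigma> t))"
    using eq_ty[OF assms(1)] by (intro axiomI ax_st_eq) (auto simp: has_ty_iff)
  then show ?thesis by (rule impE[OF _ ConjI[OF assms(2,1)]])
qed

lemma St_closed: "tyof [] t = Some \<sigma> \<Longrightarrow> P_derives \<Gamma> \<Delta> (St \<sigma> t)"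
  by (intro axiomI ax_st_closed) (simp add: has_ty_iff)

lemma St_app:
  assumes "P_derives \<Gamma> \<Delta> (St (\<sigma> \<leadsto> \<tau>) f)" "P_derives \<Gamma> \<Delta> (St \<sigma> t)"
  shows "P_derives \<Gamma> \<Delta> (St \<tau> (f \<cdot> t))"
proof -
  have "P_derives \<Gamma> \<Delta> (Imp (Conj (St (\<sigma> \<leadsto> \<tau>) f) (St \<sigma> t)) (St \<tau> (f \<cdot> t)))"
    using wf_P_derives[OF assms(1)] wf_P_derives[OF assms(2)] by (intro axiomI ax_st_app) auto
  then show ?thesis by (rule impE[OF _ ConjI[OF assms]])
qed

section \<open>Arithmetic and sequences in P\<close>

lemma eq_K:
  "tyof \<Gamma> a = Some \<sigma> \<Longrightarrow> tyof \<Gamma> b = Some \<tau> \<Longrightarrow> P_derives \<Gamma> \<Delta> (Eql \<sigma> (Con (K \<sigma> \<tau>) \<cdot> a \<cdot> b) a)"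
  by (intro EPA ax_K) (auto simp: has_ty_iff)

section \<open>Induction and case distinction\<close>

lemma nat_induct_rule:
  assumes "internal \<phi>" "wf_fm (N # \<Gamma>) \<phi>" "P_derives \<Gamma> \<Delta> (fsubst (sb [zero] 0) \<phi>)"
    and "P_derives (N # \<Gamma>) (\<phi> # map flift \<Delta>) (fsubst (sb [suc (Var 0)] (Suc 0)) \<phi>)"
    and "tyof \<Gamma> t = Some N"
  shows "P_derives \<Gamma> \<Delta> (fsubst (sb [t] 0) \<phi>)"
proof (rule ForallE)
  have "P_derives \<Gamma> \<Delta> (Imp (Conj (inst zero \<phi>) (Forall N (Imp \<phi> (succ_inst \<phi>)))) (Forall N \<phi>))"
    using assms by (intro EPA ax_induct)
  moreover have "P_derives \<Gamma> \<Delta> (Conj (inst zero \<phi>) (Forall N (Imp \<phi> (succ_inst \<phi>))))"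
    using assms by (intro ConjI allI impI) auto
  ultimately show "P_derives \<Gamma> \<Delta> (Forall N \<phi>)" by (rule impE)
qed fact

text \<open>Here \<open>\<phi>\<close> may contain \<open>St\<close>; in exchange \<open>t\<close>
  has to be standard.\<close>

lemma external_induct_rule:
  assumes "wf_fm (N # \<Gamma>) \<phi>" "P_derives \<Gamma> \<Delta> (fsubst (sb [zero] 0) \<phi>)"
    and "P_derives (N # \<Gamma>) (\<phi> # St N (Var 0) # map flift \<Delta>) (fsubst (sb [suc (Var 0)] (Suc 0)) \<phi>)"
    and "P_derives \<Gamma> \<Delta> (St N t)"
  shows "P_derives \<Gamma> \<Delta> (fsubst (sb [t] 0) \<phi>)"
proof (rule AllStE)
  have "P_derives \<Gamma> \<Delta> (Imp (Conj (inst zero \<phi>) (AllSt N (Imp \<phi> (succ_inst \<phi>)))) (AllSt N \<phi>))"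
    using assms by (intro axiomI ax_ext_induct)
  moreover have "P_derives \<Gamma> \<Delta> (Conj (inst zero \<phi>) (AllSt N (Imp \<phi> (succ_inst \<phi>))))"
    using assms by (intro ConjI AllStI impI) auto
  ultimately show "P_derives \<Gamma> \<Delta> (AllSt N \<phi>)" by (rule impE)
qed fact

lemma nat_cases_rule:
  assumes "tyof \<Gamma> t = Some N"
  shows "P_derives \<Gamma> \<Delta> (Disj (Eql N t zero) (Exists N (Eql N (lift 1 t) (suc (Var 0)))))"
proof -
  let ?\<phi> = "Disj (Eql N (Var 0) zero) (Exists N (Eql N (Var 1) (suc (Var 0))))"
  have "P_derives \<Gamma> \<Delta> (fsubst (sb [t] 0) ?\<phi>)"
  proof (rule nat_induct_rule)
    show "P_derives \<Gamma> \<Delta> (fsubst (sb [zero] 0) ?\<phi>)"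
      by (auto intro!: DisjI1 eq_refl simp: has_ty_iff)
    show "P_derives (N # \<Gamma>) (?\<phi> # map flift \<Delta>) (fsubst (sb [suc (Var 0)] (Suc 0)) ?\<phi>)"
      by (auto intro!: DisjI2 ExistsI[where t = "Var 0"] eq_refl simp: has_ty_iff)
  qed (use assms in \<open>auto simp: has_ty_iff\<close>)
  then show ?thesis by simp
qed

lemma plusT_zero: "tyof \<Gamma> m = Some N \<Longrightarrow> P_derives \<Gamma> \<Delta> (Eql N (plusT m zero) m)"
  unfolding plusT_def plusF_def by (intro EPA ax_Rec_zero) (auto simp: has_ty_iff)

lemma plusT_suc:
  assumes [simp]: "tyof \<Gamma> m = Some N" "tyof \<Gamma> n = Some N"
  shows "P_derives \<Gamma> \<Delta> (Eql N (plusT m (suc n)) (suc (plusT m n)))"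
proof -
  let ?f = "Con (K (N \<leadsto> N) N) \<cdot> Con Succ"
  have "P_derives \<Gamma> \<Delta> (Eql N (plusT m (suc n)) (?f \<cdot> n \<cdot> plusT m n))"
    unfolding plusT_def plusF_def by (intro EPA ax_Rec_suc) (auto simp: has_ty_iff)
  moreover have "P_derives \<Gamma> \<Delta> (Eql N (?f \<cdot> n \<cdot> plusT m n) (suc (plusT m n)))"
    by (intro eq_app1[where \<sigma> = N] eq_K) auto
  ultimately show ?thesis by (rule eq_trans)
qed

text \<open>With \<open>?c\<close> discarding its second argument, \<open>?f \<cdot> y\<close>
  reduces to \<open>?c \<cdot> (K \<cdot> y)\<close>. Applied to \<open>s\<close> this gives
  \<open>K \<cdot> y\<close>, which finally discards the recursive value \<open>?r\<close>.\<close>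

lemma headF_Cons:
  assumes [simp]: "tyof \<Gamma> y = Some \<sigma>" "tyof \<Gamma> s = Some (Seq \<sigma>)"
  shows "P_derives \<Gamma> \<Delta> (Eql \<sigma> (headF \<sigma> \<cdot> (Con (ConsC \<sigma>) \<cdot> y \<cdot> s)) y)"
proof -
  let ?c = "Con (K (\<sigma> \<leadsto> \<sigma>) (Seq \<sigma>))"
  let ?k = "Con (K ((\<sigma> \<leadsto> \<sigma>) \<leadsto> Seq \<sigma> \<leadsto> \<sigma> \<leadsto> \<sigma>) \<sigma>) \<cdot> ?c"
  let ?f = "Con (S \<sigma> (\<sigma> \<leadsto> \<sigma>) (Seq \<sigma> \<leadsto> \<sigma> \<leadsto> \<sigma>)) \<cdot> ?k \<cdot> Con (K \<sigma> \<sigma>)"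
  let ?r = "headF \<sigma> \<cdot> s"
  have 1: "P_derives \<Gamma> \<Delta> (Eql \<sigma> (headF \<sigma> \<cdot> (Con (ConsC \<sigma>) \<cdot> y \<cdot> s)) (?f \<cdot> y \<cdot> s \<cdot> ?r))"
    unfolding headF_def by (intro EPA ax_LRec_cons) (auto simp: has_ty_iff)
  have "P_derives \<Gamma> \<Delta> (Eql (Seq \<sigma> \<leadsto> \<sigma> \<leadsto> \<sigma>) (?f \<cdot> y) (?k \<cdot> y \<cdot> (Con (K \<sigma> \<sigma>) \<cdot> y)))"
    by (intro EPA ax_S) (auto simp: has_ty_iff)
  moreover have "P_derives \<Gamma> \<Delta> (Eql (Seq \<sigma> \<leadsto> \<sigma> \<leadsto> \<sigma>) (?k \<cdot> y \<cdot> (Con (K \<sigma> \<sigma>) \<cdot> y))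
      (?c \<cdot> (Con (K \<sigma> \<sigma>) \<cdot> y)))"
    by (intro eq_app1[where \<sigma> = "\<sigma> \<leadsto> \<sigma>"] eq_K) auto
  ultimately have "P_derives \<Gamma> \<Delta> (Eql (Seq \<sigma> \<leadsto> \<sigma> \<leadsto> \<sigma>) (?f \<cdot> y) (?c \<cdot> (Con (K \<sigma> \<sigma>) \<cdot> y)))"
    by (rule eq_trans)
  then have "P_derives \<Gamma> \<Delta> (Eql (\<sigma> \<leadsto> \<sigma>) (?f \<cdot> y \<cdot> s) (?c \<cdot> (Con (K \<sigma> \<sigma>) \<cdot> y) \<cdot> s))"
    by (rule eq_app1) simp
  moreover have "P_derives \<Gamma> \<Delta> (Eql (\<sigma> \<leadsto> \<sigma>) (?c \<cdot> (Con (K \<sigma> \<sigma>) \<cdot> y) \<cdot> s) (Con (K \<sigma> \<sigma>) \<cdot> y))"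
    by (intro eq_K) auto
  ultimately have "P_derives \<Gamma> \<Delta> (Eql (\<sigma> \<leadsto> \<sigma>) (?f \<cdot> y \<cdot> s) (Con (K \<sigma> \<sigma>) \<cdot> y))"
    by (rule eq_trans)
  then have "P_derives \<Gamma> \<Delta> (Eql \<sigma> (?f \<cdot> y \<cdot> s \<cdot> ?r) (Con (K \<sigma> \<sigma>) \<cdot> y \<cdot> ?r))"
    by (rule eq_app1) simp
  moreover have "P_derives \<Gamma> \<Delta> (Eql \<sigma> (Con (K \<sigma> \<sigma>) \<cdot> y \<cdot> ?r) y)"
    by (intro eq_K) auto
  ultimately show ?thesis using 1 eq_trans by blast
qed

lemma lenT_Nil: "P_derives \<Gamma> \<Delta> (Eql N (lenT \<sigma> (Con (NilC \<sigma>))) zero)"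
  unfolding lenT_def by (intro EPA ax_LRec_nil) (auto simp: has_ty_iff)

lemma lenT_Cons:
  assumes [simp]: "tyof \<Gamma> y = Some \<sigma>" "tyof \<Gamma> s = Some (Seq \<sigma>)"
  shows "P_derives \<Gamma> \<Delta> (Eql N (lenT \<sigma> (Con (ConsC \<sigma>) \<cdot> y \<cdot> s)) (suc (lenT \<sigma> s)))"
proof -
  let ?g = "Con (K (N \<leadsto> N) (Seq \<sigma>)) \<cdot> Con Succ"
  let ?f = "Con (K (Seq \<sigma> \<leadsto> N \<leadsto> N) \<sigma>) \<cdot> ?g"
  have 1: "P_derives \<Gamma> \<Delta> (Eql N (lenT \<sigma> (Con (ConsC \<sigma>) \<cdot> y \<cdot> s)) (?f \<cdot> y \<cdot> s \<cdot> lenT \<sigma> s))"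
    unfolding lenT_def by (intro EPA ax_LRec_cons) (auto simp: has_ty_iff)
  have "P_derives \<Gamma> \<Delta> (Eql (N \<leadsto> N) (?f \<cdot> y \<cdot> s) (?g \<cdot> s))"
    by (intro eq_app1[where \<sigma> = "Seq \<sigma>"] eq_K) auto
  moreover have "P_derives \<Gamma> \<Delta> (Eql (N \<leadsto> N) (?g \<cdot> s) (Con Succ))"
    by (intro eq_K) auto
  ultimately have "P_derives \<Gamma> \<Delta> (Eql (N \<leadsto> N) (?f \<cdot> y \<cdot> s) (Con Succ))"
    by (rule eq_trans)
  then have "P_derives \<Gamma> \<Delta> (Eql N (?f \<cdot> y \<cdot> s \<cdot> lenT \<sigma> s) (suc (lenT \<sigma> s)))"
    by (rule eq_app1) simp
  with 1 show ?thesis by (rule eq_trans)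
qed

text \<open>The sequence of \<open>n\<close> zero functionals as a function of \<open>n\<close>.
  Being a closed term it is standard, so every standard number is the length of a standard sequence;
  this justifies reading \<open>k\<close> off a sequence.\<close>

definition zerosF :: "ty \<Rightarrow> tm" where
  "zerosF \<sigma> = Con (Rec (Seq \<sigma>)) \<cdot> Con (NilC \<sigma>) \<cdot>
     (Con (K (Seq \<sigma> \<leadsto> Seq \<sigma>) N) \<cdot> (Con (ConsC \<sigma>) \<cdot> zeroT \<sigma>))"

lemma tsubst_zerosF [simp]: "tsubst f (zerosF \<sigma>) = zerosF \<sigma>"
  by (simp add: zerosF_def)

lemma tyof_zerosF [simp]: "tyof \<Gamma> (zerosF \<sigma>) = Some (N \<leadsto> Seq \<sigma>)"
  by (simp add: zerosF_def)

lemma lenT_cong: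
  "P_derives \<Gamma> \<Delta> (Eql (Seq \<sigma>) s t) \<Longrightarrow> P_derives \<Gamma> \<Delta> (Eql N (lenT \<sigma> s) (lenT \<sigma> t))"
  unfolding lenT_def by (erule eq_app2) simp

lemma lenT_zerosF:
  assumes "tyof \<Gamma> n = Some N"
  shows "P_derives \<Gamma> \<Delta> (Eql N (lenT \<sigma> (zerosF \<sigma> \<cdot> n)) n)"
proof -
  let ?\<phi> = "Eql N (lenT \<sigma> (zerosF \<sigma> \<cdot> Var 0)) (Var 0)"
  have "P_derives \<Gamma> \<Delta> (fsubst (sb [n] 0) ?\<phi>)"
  proof (rule nat_induct_rule)
    have "P_derives \<Gamma> \<Delta> (Eql (Seq \<sigma>) (zerosF \<sigma> \<cdot> zero) (Con (NilC \<sigma>)))"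
      unfolding zerosF_def by (intro EPA ax_Rec_zero) (auto simp: has_ty_iff)
    then show "P_derives \<Gamma> \<Delta> (fsubst (sb [zero] 0) ?\<phi>)"
      using eq_trans[OF lenT_cong lenT_Nil] by simp
    let ?\<Gamma> = "N # \<Gamma>" and ?\<Delta> = "?\<phi> # map flift \<Delta>"
    let ?f = "Con (ConsC \<sigma>) \<cdot> zeroT \<sigma>" and ?s = "zerosF \<sigma> \<cdot> Var 0"
    have "P_derives ?\<Gamma> ?\<Delta> (Eql (Seq \<sigma>) (zerosF \<sigma> \<cdot> suc (Var 0))
        (Con (K (Seq \<sigma> \<leadsto> Seq \<sigma>) N) \<cdot> ?f \<cdot> Var 0 \<cdot> ?s))"
      unfolding zerosF_def by (intro EPA ax_Rec_suc) (auto simp: has_ty_iff)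
    moreover have "P_derives ?\<Gamma> ?\<Delta> (Eql (Seq \<sigma>)
        (Con (K (Seq \<sigma> \<leadsto> Seq \<sigma>) N) \<cdot> ?f \<cdot> Var 0 \<cdot> ?s) (?f \<cdot> ?s))"
      by (intro eq_app1[where \<sigma> = "Seq \<sigma>"] eq_K) auto
    ultimately have "P_derives ?\<Gamma> ?\<Delta> (Eql (Seq \<sigma>) (zerosF \<sigma> \<cdot> suc (Var 0)) (?f \<cdot> ?s))"
      by (rule eq_trans)
    then have "P_derives ?\<Gamma> ?\<Delta> (Eql N (lenT \<sigma> (zerosF \<sigma> \<cdot> suc (Var 0))) (lenT \<sigma> (?f \<cdot> ?s)))"
      by (rule lenT_cong)
    moreover have "P_derives ?\<Gamma> ?\<Delta> (Eql N (lenT \<sigma> (?f \<cdot> ?s)) (suc (lenT \<sigma> ?s)))"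
      by (intro lenT_Cons) auto
    moreover have "P_derives ?\<Gamma> ?\<Delta> (Eql N (suc (lenT \<sigma> ?s)) (suc (Var 0)))"
      by (intro eq_app2[where \<sigma> = N] hypI) (auto simp: has_ty_iff)
    ultimately show "P_derives ?\<Gamma> ?\<Delta> (fsubst (sb [suc (Var 0)] (Suc 0)) ?\<phi>)"
      by simp (metis eq_trans)
  qed (use assms in \<open>auto simp: has_ty_iff\<close>)
  then show ?thesis by simp
qed

section \<open>Order, and standardness below a standard bound\<close>

lemma suc_inject_rule:
  assumes "P_derives \<Gamma> \<Delta> (Eql N (suc m) (suc n))" "tyof \<Gamma> m = Some N" "tyof \<Gamma> n = Some N"
  shows "P_derives \<Gamma> \<Delta> (Eql N m n)"
  by (rule impE[OF EPA assms(1)]) (use assms in \<open>auto simp: has_ty_iff intro: ax_suc_inj\<close>)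

lemma suc_zero_BotE:
  assumes "P_derives \<Gamma> \<Delta> (Eql N (suc n) zero)" "tyof \<Gamma> n = Some N"
  shows "P_derives \<Gamma> \<Delta> Bot"
  by (rule NegE[OF EPA assms(1)]) (use assms in \<open>auto simp: has_ty_iff intro: ax_suc_nonzero\<close>)

lemma LessF_I:
  assumes "P_derives \<Gamma> \<Delta> (Eql N (suc (plusT m k)) n)"
    and [simp]: "tyof \<Gamma> m = Some N" "tyof \<Gamma> k = Some N"
  shows "P_derives \<Gamma> \<Delta> (LessF m n)"
  unfolding LessF_def
  by (rule ExistsI[where t = k]) (use assms eq_ty[OF assms(1)] in \<open>auto simp: has_ty_iff\<close>)

lemma plusT_cong:
  "P_derives \<Gamma> \<Delta> (Eql N n k) \<Longrightarrow> tyof \<Gamma> m = Some N \<Longrightarrow>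
    P_derives \<Gamma> \<Delta> (Eql N (plusT m n) (plusT m k))"
  unfolding plusT_def by (erule eq_app2) (simp add: plusF_def)

text \<open>External induction on the bound \<open>n\<close>. Nothing lies below zero. If
  \<open>i < n + 1\<close>, then \<open>i + k = n\<close> for some \<open>k\<close>: for
  \<open>k = 0\<close> the number \<open>i\<close> is \<open>n\<close> itself, and for
  \<open>k = j + 1\<close> one has \<open>i < n\<close>, so the induction hypothesis
  applies.\<close>

lemma St_below:
  assumes "P_derives \<Gamma> \<Delta> (St N n)" "P_derives \<Gamma> \<Delta> (LessF i n)" and i: "tyof \<Gamma> i = Some N"
  shows "P_derives \<Gamma> \<Delta> (St N i)"
proof -
  let ?\<phi> = "Forall N (Imp (LessF (Var 0) (Var 1)) (St N (Var 0)))"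
  have "P_derives \<Gamma> \<Delta> (fsubst (sb [n] 0) ?\<phi>)"
  proof (rule external_induct_rule[OF _ _ _ assms(1)])
    let ?\<Gamma> = "N # \<Gamma>" and ?\<Delta> = "LessF (Var 0) zero # map flift \<Delta>"
    have "P_derives ?\<Gamma> ?\<Delta> (St N (Var 0))"
    proof (rule ExistsE[of _ _ N "Eql N (suc (plusT (Var 1) (Var 0))) zero"])
      have "P_derives ?\<Gamma> ?\<Delta> (LessF (Var 0) zero)" by (intro hypI) auto
      then show "P_derives ?\<Gamma> ?\<Delta> (Exists N (Eql N (suc (plusT (Var 1) (Var 0))) zero))"
        by (simp add: LessF_def)
      show "P_derives (N # ?\<Gamma>) (Eql N (suc (plusT (Var 1) (Var 0))) zero # map flift ?\<Delta>)
          (flift (St N (Var 0)))"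
        by (rule BotE[OF suc_zero_BotE[OF hypI]]) (auto simp: has_ty_iff)
    qed (simp add: has_ty_iff)
    then show "P_derives \<Gamma> \<Delta> (fsubst (sb [zero] 0) ?\<phi>)"
      by simp (intro allI impI, auto)
  next
    let ?\<Gamma> = "N # N # \<Gamma>"
    let ?\<Delta> = "LessF (Var 0) (suc (Var 1)) # map flift (?\<phi> # St N (Var 0) # map flift \<Delta>)"
    \<comment> \<open>Here \<open>Var 0\<close> is the witness \<open>k\<close>,
      \<open>Var 1\<close> is \<open>i\<close> and \<open>Var 2\<close> is \<open>n\<close>.\<close>
    let ?e = "Eql N (suc (plusT (Var 1) (Var 0))) (suc (Var 2))"
    have "P_derives ?\<Gamma> ?\<Delta> (St N (Var 0))"
    proof (rule ExistsE[of _ _ N ?e])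
      have "P_derives ?\<Gamma> ?\<Delta> (LessF (Var 0) (suc (Var 1)))" by (intro hypI) auto
      then show "P_derives ?\<Gamma> ?\<Delta> (Exists N ?e)"
        by (simp add: LessF_def)
      let ?\<Gamma>' = "N # ?\<Gamma>" and ?\<Delta>' = "?e # map flift ?\<Delta>"
      have e: "P_derives ?\<Gamma>' \<Theta> (Eql N (plusT (Var 1) (Var 0)) (Var 2))" if "?e \<in> set \<Theta>" for \<Theta>
        by (rule suc_inject_rule[OF hypI]) (use that in \<open>auto simp: has_ty_iff\<close>)
      show "P_derives ?\<Gamma>' ?\<Delta>' (flift (St N (Var 0)))"
      proof (rule DisjE[OF nat_cases_rule[of _ "Var 0"]])
        let ?\<Theta> = "Eql N (Var 0) zero # ?\<Delta>'"
        have "P_derives ?\<Gamma>' ?\<Theta> (Eql N (plusT (Var 1) (Var 0)) (plusT (Var 1) zero))"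
          by (intro plusT_cong hypI) (auto simp: has_ty_iff)
        moreover have "P_derives ?\<Gamma>' ?\<Theta> (Eql N (plusT (Var 1) zero) (Var 1))"
          by (intro plusT_zero) auto
        ultimately have "P_derives ?\<Gamma>' ?\<Theta> (Eql N (plusT (Var 1) (Var 0)) (Var 1))"
          by (rule eq_trans)
        then have "P_derives ?\<Gamma>' ?\<Theta> (Eql N (Var 2) (Var 1))"
          by - (rule eq_trans[OF eq_sym[OF e]], simp)
        moreover have "P_derives ?\<Gamma>' ?\<Theta> (St N (Var 2))"
          by (intro hypI) (auto simp: has_ty_iff)
        ultimately show "P_derives ?\<Gamma>' ?\<Theta> (flift (St N (Var 0)))"
          using St_eq by simp
      next
        let ?d = "Eql N (lift 1 (Var 0)) (suc (Var 0))"
        let ?\<Theta> = "Exists N ?d # ?\<Delta>'"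
        show "P_derives ?\<Gamma>' ?\<Theta> (flift (St N (Var 0)))"
        proof (rule ExistsE[of _ _ N ?d])
          show "P_derives ?\<Gamma>' ?\<Theta> (Exists N ?d)" by (intro hypI) (auto simp: has_ty_iff)
          let ?\<Gamma>'' = "N # ?\<Gamma>'" and ?\<Delta>'' = "?d # map flift ?\<Theta>"
          have "P_derives ?\<Gamma>'' ?\<Delta>'' (Eql N (suc (plusT (Var 2) (Var 1))) (suc (Var 3)))"
            by (intro hypI) (auto simp: has_ty_iff)
          then have "P_derives ?\<Gamma>'' ?\<Delta>'' (Eql N (plusT (Var 2) (Var 1)) (Var 3))"
            by (rule suc_inject_rule) auto
          then have "P_derives ?\<Gamma>'' ?\<Delta>'' (Eql N (plusT (Var 2) (suc (Var 0))) (Var 3))"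
            by (rule eq_trans[rotated])
              (intro plusT_cong eq_sym[OF hypI], auto simp: has_ty_iff)
          moreover have "P_derives ?\<Gamma>'' ?\<Delta>'' (Eql N (plusT (Var 2) (suc (Var 0))) (suc (plusT (Var 2) (Var 0))))"
            by (intro plusT_suc) auto
          ultimately have "P_derives ?\<Gamma>'' ?\<Delta>'' (Eql N (suc (plusT (Var 2) (Var 0))) (Var 3))"
            by - (rule eq_trans[OF eq_sym])
          \<comment> \<open>The predecessor \<open>j\<close> of \<open>k\<close>, now
            \<open>Var 0\<close>, witnesses \<open>i < n\<close>.\<close>
          then have less: "P_derives ?\<Gamma>'' ?\<Delta>'' (LessF (Var 2) (Var 3))"
            by (rule LessF_I) auto
          \<comment> \<open>This is the induction hypothesis: \<open>n\<close> has become
            \<open>Var 3\<close>, hence \<open>Var 4\<close> below the quantifier.\<close>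
          have "P_derives ?\<Gamma>'' ?\<Delta>'' (Forall N (Imp (LessF (Var 0) (Var 4)) (St N (Var 0))))"
            by (intro hypI) (auto simp: has_ty_iff)
          from ForallE[OF this, of "Var 2"]
          have "P_derives ?\<Gamma>'' ?\<Delta>'' (Imp (LessF (Var 2) (Var 3)) (St N (Var 2)))"
            by simp
          then have "P_derives ?\<Gamma>'' ?\<Delta>'' (St N (Var 2))"
            using less by (rule impE)
          then show "P_derives ?\<Gamma>'' ?\<Delta>'' (flift (flift (St N (Var 0))))"
            by simp
        qed (simp add: has_ty_iff)
      qed simp
    qed (simp add: has_ty_iff)
    then show "P_derives (N # \<Gamma>) (?\<phi> # St N (Var 0) # map flift \<Delta>)
        (fsubst (sb [suc (Var 0)] (Suc 0)) ?\<phi>)"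
      by simp (intro allI impI, auto simp: has_ty_iff)
  qed (simp add: has_ty_iff)
  from ForallE[OF this[simplified] i] have "P_derives \<Gamma> \<Delta> (Imp (LessF i n) (St N i))"
    by simp
  then show ?thesis using assms(2) by (rule impE)
qed

lemma St_lenT: "P_derives \<Gamma> \<Delta> (St (Seq \<sigma>) s) \<Longrightarrow> P_derives \<Gamma> \<Delta> (St N (lenT \<sigma> s))"
  unfolding lenT_def by (rule St_app[OF St_closed]) auto

lemma St_nthT:
  "P_derives \<Gamma> \<Delta> (St (Seq \<sigma>) s) \<Longrightarrow> P_derives \<Gamma> \<Delta> (St N i) \<Longrightarrow>
    P_derives \<Gamma> \<Delta> (St \<sigma> (nthT \<sigma> s i))"
  unfolding nthT_def
  by (rule St_app[OF St_closed St_app[OF St_app[OF St_app[OF St_closed] St_closed]]]) auto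

text \<open>An entry is \<open>nthT \<sigma> s i\<close> with \<open>i\<close> below the length of
  \<open>s\<close>. The length is standard, so \<open>St_below\<close> makes \<open>i\<close>
  standard, and the entry is obtained by applying closed terms to standard arguments.\<close>

lemma St_member:
  assumes st: "P_derives \<Gamma> \<Delta> (St (Seq \<sigma>) s)" and mem: "P_derives \<Gamma> \<Delta> (MemF \<sigma> z s)"
    and z: "tyof \<Gamma> z = Some \<sigma>" and "St (Seq \<sigma>) s \<in> set \<Delta>"
  shows "P_derives \<Gamma> \<Delta> (St \<sigma> z)"
proof (rule ExistsE[OF mem[unfolded MemF_def]])
  have [simp]: "tyof \<Gamma> s = Some (Seq \<sigma>)"
    using wf_P_derives[OF st] by (simp add: has_ty_iff)
  let ?s = "lift 1 s"
  let ?l = "LessF (Var 0) (lenT \<sigma> ?s)" and ?e = "Eql \<sigma> (lift 1 z) (nthT \<sigma> ?s (Var 0))"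
  let ?\<Gamma> = "N # \<Gamma>" and ?\<Delta> = "Conj ?l ?e # map flift \<Delta>"
  have C: "P_derives ?\<Gamma> ?\<Delta> (Conj ?l ?e)"
    using z by (intro hypI) (auto simp: has_ty_iff)
  \<comment> \<open>The standardness of \<open>s\<close> is taken from the hypothesis list, whose
    members are lifted past the new index variable.\<close>
  have s: "P_derives ?\<Gamma> ?\<Delta> (St (Seq \<sigma>) ?s)"
    using assms(4) by (intro hypI) (force simp: has_ty_iff)+
  from St_below[OF St_lenT[OF this] ConjD1[OF C]] have i: "P_derives ?\<Gamma> ?\<Delta> (St N (Var 0))"
    by simp
  from St_eq[OF eq_sym[OF ConjD2[OF C]] St_nthT[OF s i]]
  show "P_derives ?\<Gamma> ?\<Delta> (flift (St \<sigma> z))" by simp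
qed (use z in \<open>simp add: has_ty_iff\<close>)

section \<open>Reals\<close>

lemma tyof_arith [simp]:
  "tyof \<Gamma> m = Some N \<Longrightarrow> tyof \<Gamma> n = Some N \<Longrightarrow> tyof \<Gamma> (timesT m n) = Some N"
  "tyof \<Gamma> n = Some N \<Longrightarrow> tyof \<Gamma> (pow2T n) = Some N"
  "tyof \<Gamma> twoT = Some N"
  by (simp_all add: timesT_def timesF_def plusF_def pow2T_def twoT_def)

lemma internal_RatVal: "internal (RatVal q p m d)"
  by (simp add: RatVal_def Let_def)

lemma wf_RatVal:
  "tyof \<Gamma> q = Some N \<Longrightarrow> tyof \<Gamma> p = Some N \<Longrightarrow> tyof \<Gamma> m = Some N \<Longrightarrow> tyof \<Gamma> d = Some N \<Longrightarrow>
    wf_fm \<Gamma> (RatVal q p m d)"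
  by (simp add: RatVal_def Let_def has_ty_iff)

lemma internal_IsReal: "internal (IsReal f)"
  by (simp add: IsReal_def RatDistLess_def Let_def internal_RatVal)

lemma wf_IsReal: "wf_fm (RealTy # \<Gamma>) (IsReal (Var 0))"
  by (simp add: IsReal_def RatDistLess_def Let_def wf_RatVal)

lemma internal_AbsLessRecip: "internal (AbsLessRecip f k)"
  by (simp add: AbsLessRecip_def Let_def internal_RatVal)

lemma wf_AbsLessRecip: "wf_fm (N # RealTy # \<Gamma>) (AbsLessRecip (Var 1) (Var 0))"
  by (simp add: AbsLessRecip_def Let_def wf_RatVal)

section \<open>The normal form\<close>

context
  fixes \<Gamma> :: "ty list" and \<epsilon> \<sigma> \<tau> :: ty and \<rho> \<beta> \<phi> :: fm
  assumes internal: "internal \<rho>" "internal \<beta>" "internal \<phi>"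
    and wf: "wf_fm (\<epsilon> # \<Gamma>) \<rho>" "wf_fm (N # \<epsilon> # \<Gamma>) \<beta>" "wf_fm (\<tau> # \<sigma> # \<epsilon> # \<Gamma>) \<phi>"
begin

text \<open>The left-hand side with the reals abstracted away: \<open>\<rho>\<close> stands for
  being a real and \<open>\<beta>\<close> for the bound indexed by \<open>k\<close>.\<close>

definition original where
  "original = Forall \<epsilon> (Imp \<rho> (Imp (AllSt N \<beta>) (AllSt \<sigma> (ExSt \<tau> \<phi>))))"

text \<open>The variables of \<open>counterexample\<close> are \<open>z, \<epsilon>, x\<close>, those of \<open>refuted\<close> are \<open>w, x\<close>.\<close>

definition counterexample where
  "counterexample = Conj (fsubst (sb [Var 1] 3) \<rho>)
     (Conj (fsubst (sb [lenT \<tau> (Var 0), Var 1] 3) \<beta>)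
           (Neg (fsubst (sb [headF \<tau> \<cdot> Var 0, Var 2, Var 1] 3) \<phi>)))"

definition refuted where
  "refuted = Exists \<epsilon> (Forall (Seq \<tau>)
     (Imp (MemF (Seq \<tau>) (Var 0) (Var 2)) (weaken2 counterexample)))"

lemma internal_counterexample: "internal counterexample"
  using internal by (simp add: counterexample_def)

lemma internal_refuted: "internal refuted"
  using internal_counterexample by (simp add: refuted_def)

lemma wf_counterexample: "wf_fm (Seq \<tau> # \<epsilon> # \<sigma> # \<Gamma>) counterexample"
  using wf by (auto simp: counterexample_def elim!: wf_fsubst_sb)

lemma wf_original: "wf_fm \<Gamma> original"
  using wf by (simp add: original_def)

lemma wf_refuted: "wf_fm (Seq (Seq \<tau>) # \<sigma> # \<Gamma>) refuted"
  using wf_fsubst_sb[OF wf_counterexample] by (auto simp: refuted_def)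

text \<open>The \<open>\<epsilon>\<close> supplied by idealisation is tested at three standard
  sequences: the empty one yields \<open>\<rho>\<close>, zeros of length \<open>k\<close> yield the
  bound at \<open>k\<close>, and the singleton of \<open>y\<close> contradicts \<open>\<phi>\<close>
  at \<open>y\<close>.\<close>

lemma normal_form_forward:
  "P_derives \<Gamma> [original] (AllSt \<sigma> (ExSt (Seq (Seq \<tau>)) (Neg refuted)))"
proof (rule AllStI)
  let ?G = "\<sigma> # \<Gamma>" and ?D = "[St \<sigma> (Var 0), flift original]"
  let ?C = "ExSt (Seq (Seq \<tau>)) (Neg refuted)"
  have wfC: "wf_fm ?G ?C" using wf_refuted by simp
  have "P_derives ?G ?D ?C"
  proof (rule classical[OF wfC])
    let ?D1 = "Neg ?C # ?D"
    have "P_derives ?G ?D1 (Neg ?C)"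
      using wfC by (intro hypI) auto
    then have *: "P_derives ?G ?D1 (AllSt (Seq (Seq \<tau>)) refuted)"
      by (rule not_ExSt_not)
    \<comment> \<open>\<open>refuted\<close> has literally the shape of the idealisation premise for
      \<open>counterexample\<close>, with entries of type \<open>Seq \<tau>\<close>.\<close>
    have ideal: "P_derives ?G ?D1 (Exists \<epsilon> (AllSt (Seq \<tau>) counterexample))"
      by (rule impE[OF axiomI[OF ax_idealisation]])
        (use internal_counterexample wf_counterexample * in \<open>auto simp: refuted_def\<close>)
    show "P_derives ?G ?D1 Bot"
    proof (rule ExistsE[OF ideal])
      let ?G2 = "\<epsilon> # ?G" and ?D2 = "AllSt (Seq \<tau>) counterexample # map flift ?D1"
      have ce: "P_derives ?G2 ?D2 (AllSt (Seq \<tau>) counterexample)"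
        using wf_counterexample by (intro hypI) auto
      have "P_derives ?G2 ?D2 (flift (flift original))"
        using wf_lift[OF wf_lift[OF wf_original]] by (intro hypI) auto
      from ForallE[OF this[unfolded original_def, simplified], of "Var 0"]
      have h: "P_derives ?G2 ?D2 (Imp (fsubst (sb [Var 0] 2) \<rho>)
          (Imp (AllSt N (fsubst (sb [Var 0, Var 1] 3) \<beta>))
               (AllSt \<sigma> (ExSt \<tau> (fsubst (sb [Var 0, Var 1, Var 2] 4) \<phi>)))))"
        by (simp add: original_def)
      \<comment> \<open>The conjunct \<open>\<rho>\<close> does not depend on \<open>z\<close>, so
        any standard value serves.\<close>
      have "P_derives ?G2 ?D2 (fsubst (sb [Con (NilC \<tau>)] 0) counterexample)"
        by (rule AllStE[OF ce St_closed]) simp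
      then have r: "P_derives ?G2 ?D2 (fsubst (sb [Var 0] 2) \<rho>)"
        unfolding counterexample_def by simp (rule ConjD1)
      have b: "P_derives ?G2 ?D2 (AllSt N (fsubst (sb [Var 0, Var 1] 3) \<beta>))"
      proof (rule AllStI)
        let ?G3 = "N # ?G2" and ?D3 = "St N (Var 0) # map flift ?D2"
        have ce: "P_derives ?G3 ?D3 (AllSt (Seq \<tau>) (fsubst (sb [Var 0] 2) counterexample))"
          by (rule hypI) (auto intro!: wf_fsubst_sb[OF wf_counterexample])
        have st: "P_derives ?G3 ?D3 (St (Seq \<tau>) (zerosF \<tau> \<cdot> Var 0))"
          by (rule St_app[OF St_closed hypI]) (auto simp: has_ty_iff)
        from AllStE[OF ce st]
        have "P_derives ?G3 ?D3 (fsubst (sb [lenT \<tau> (zerosF \<tau> \<cdot> Var 0), Var 1] 3) \<beta>)"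
          unfolding counterexample_def by (auto dest: ConjD1 ConjD2)
        moreover have "P_derives ?G3 ?D3 (Eql N (lenT \<tau> (zerosF \<tau> \<cdot> Var 0)) (Var 0))"
          by (rule lenT_zerosF) simp
        \<comment> \<open>In the template the hole is \<open>Var 0\<close>, which pushes
          \<open>\<epsilon>\<close> to \<open>Var 2\<close>; the length of the zero sequence is
          replaced by \<open>k\<close>.\<close>
        ultimately show "P_derives ?G3 ?D3 (fsubst (sb [Var 0, Var 1] 3) \<beta>)"
          using leibniz[of ?G3 ?D3 N "lenT \<tau> (zerosF \<tau> \<cdot> Var 0)" "Var 0" "fsubst (sb [Var 0, Var 2] 4) \<beta>"]
            internal wf_fsubst_sb[OF wf(2), of "N # ?G3" "[Var 0, Var 2]" 4] by simp
      qed
      have "P_derives ?G2 ?D2 (AllSt \<sigma> (ExSt \<tau> (fsubst (sb [Var 0, Var 1, Var 2] 4) \<phi>)))"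
        by (rule impE[OF impE[OF h r] b])
      moreover have "P_derives ?G2 ?D2 (St \<sigma> (Var 1))"
        by (intro hypI) (auto simp: has_ty_iff)
      ultimately have ex: "P_derives ?G2 ?D2 (ExSt \<tau> (fsubst (sb [Var 0, Var 2, Var 1] 3) \<phi>))"
        using AllStE[of ?G2 ?D2 \<sigma> _ "Var 1"] by fastforce
      show "P_derives ?G2 ?D2 (flift Bot)"
      proof (rule ExStE[OF ex])
        let ?p = "fsubst (sb [Var 0, Var 2, Var 1] 3) \<phi>"
        let ?G3 = "\<tau> # ?G2" and ?D3 = "?p # St \<tau> (Var 0) # map flift ?D2"
        \<comment> \<open>The singleton of the standard witness \<open>y\<close>: its head is
          \<open>y\<close>, so \<open>counterexample\<close> denies what \<open>?p\<close>
          asserts.\<close>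
        let ?s = "Con (ConsC \<tau>) \<cdot> Var 0 \<cdot> Con (NilC \<tau>)"
        have ce: "P_derives ?G3 ?D3 (AllSt (Seq \<tau>) (fsubst (sb [Var 0] 2) counterexample))"
          by (rule hypI) (auto intro!: wf_fsubst_sb[OF wf_counterexample])
        have st: "P_derives ?G3 ?D3 (St (Seq \<tau>) ?s)"
          by (rule St_app[OF St_app[OF St_closed hypI] St_closed]) (auto simp: has_ty_iff)
        from AllStE[OF ce st]
        have n: "P_derives ?G3 ?D3 (Neg (fsubst (sb [headF \<tau> \<cdot> ?s, Var 2, Var 1] 3) \<phi>))"
          unfolding counterexample_def by (auto dest: ConjD2)
        have "P_derives ?G3 ?D3 ?p"
          by (rule hypI) (auto intro!: wf_fsubst_sb[OF wf(3)])
        moreover have "P_derives ?G3 ?D3 (Eql \<tau> (Var 0) (headF \<tau> \<cdot> ?s))"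
          by (rule eq_sym[OF headF_Cons]) auto
        ultimately have "P_derives ?G3 ?D3 (fsubst (sb [headF \<tau> \<cdot> ?s, Var 2, Var 1] 3) \<phi>)"
          using leibniz[of ?G3 ?D3 \<tau> "Var 0" "headF \<tau> \<cdot> ?s" "fsubst (sb [Var 0, Var 3, Var 2] 4) \<phi>"]
            internal wf_fsubst_sb[OF wf(3), of "\<tau> # ?G3" "[Var 0, Var 3, Var 2]" 4] by simp
        with n show "P_derives ?G3 ?D3 (flift (flift Bot))"
          by simp (rule NegE)
      qed simp
    qed simp
  qed
  then show "P_derives ?G (St \<sigma> (Var 0) # map flift [original]) ?C" by simp
qed

text \<open>Take \<open>w\<close> for the standard \<open>x\<close>. If no standard \<open>y\<close>
  satisfied \<open>\<phi>\<close>, the given \<open>\<epsilon>\<close> would defeat every entry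
  \<open>z\<close> of \<open>w\<close>: such a \<open>z\<close> is standard, hence so are its
  length, where the bound holds, and its head, where \<open>\<phi>\<close> fails.\<close>

lemma normal_form_backward:
  "P_derives \<Gamma> [AllSt \<sigma> (ExSt (Seq (Seq \<tau>)) (Neg refuted))] original"
  unfolding original_def
proof (rule allI, rule impI[OF wf(1)], rule impI, use wf in simp, rule AllStI)
  let ?T = "Seq (Seq \<tau>)"
  let ?H = "AllSt \<sigma> (ExSt ?T (Neg refuted))"
  let ?G = "\<sigma> # \<epsilon> # \<Gamma>"
  let ?D = "St \<sigma> (Var 0) # map flift (AllSt N \<beta> # \<rho> # map flift [?H])"
  have "P_derives ?G ?D (flift (flift ?H))"
    by (intro hypI wf_lift) (use wf_refuted in auto)
  moreover have "P_derives ?G ?D (St \<sigma> (Var 0))"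
    by (intro hypI) (auto simp: has_ty_iff)
  \<comment> \<open>\<open>refuted\<close> speaks of \<open>w\<close> and \<open>x\<close> only, so
    the parameters start at 3 to skip \<open>\<epsilon>\<close>.\<close>
  ultimately have ex: "P_derives ?G ?D (ExSt ?T (Neg (fsubst (sb [Var 0, Var 1] 3) refuted)))"
    using AllStE[of ?G ?D \<sigma> _ "Var 0"] by fastforce
  show "P_derives ?G ?D (ExSt \<tau> \<phi>)"
  proof (rule ExStE[OF ex])
    let ?r = "fsubst (sb [Var 0, Var 1] 3) refuted"
    let ?G1 = "?T # ?G" and ?D1 = "Neg ?r # St ?T (Var 0) # map flift ?D"
    let ?C = "ExSt \<tau> (fsubst (sb [Var 0, Var 2, Var 3] 4) \<phi>)"
    let ?D2 = "Neg ?C # ?D1"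
    have wfr: "wf_fm ?G1 ?r" by (auto intro!: wf_fsubst_sb[OF wf_refuted])
    have wfC: "wf_fm ?G1 ?C" by (auto intro!: wf_fsubst_sb[OF wf(3)])
    let ?q = "Forall (Seq \<tau>) (Imp (MemF (Seq \<tau>) (Var 0) (Var 2))
        (fsubst (sb [Var 0, Var 1, Var 3] 5) counterexample))"
    have "P_derives ?G1 ?D2 (Exists \<epsilon> ?q)"
    \<comment> \<open>The variables of \<open>?G1\<close> are \<open>w, x, \<epsilon>\<close>, so
      the witness is the given \<open>\<epsilon>\<close>.\<close>
    proof (rule ExistsI[where t = "Var 2"])
      let ?m = "MemF (Seq \<tau>) (Var 0) (Var 1)"
      let ?G3 = "Seq \<tau> # ?G1" and ?D3 = "?m # map flift ?D2"
      let ?r' = "fsubst (sb [Var 3] 4) \<rho>"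
      let ?b' = "fsubst (sb [lenT \<tau> (Var 0), Var 3] 4) \<beta>"
      let ?p' = "fsubst (sb [headF \<tau> \<cdot> Var 0, Var 2, Var 3] 4) \<phi>"
      have sts: "P_derives ?G3 ?D3 (St ?T (Var 1))"
        by (intro hypI) (auto simp: has_ty_iff)
      have m: "P_derives ?G3 ?D3 ?m"
        by (intro hypI) auto
      have st: "P_derives ?G3 ?D3 (St (Seq \<tau>) (Var 0))"
        by (rule St_member[OF sts m]) auto
      have r: "P_derives ?G3 ?D3 ?r'"
        by (rule hypI) (auto simp: sb_trim(1)[of 3, simplified] intro!: wf_fsubst_sb[OF wf(1)])
      have "P_derives ?G3 ?D3 (AllSt N (fsubst (sb [Var 0, Var 4] 5) \<beta>))"
        by (rule hypI) (auto simp: sb_trim(2)[of _ 4, simplified] intro!: wf_fsubst_sb[OF wf(2)])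
      from AllStE[OF this St_lenT[OF st]] have b: "P_derives ?G3 ?D3 ?b'"
        by simp
      have wfp: "wf_fm ?G3 ?p'" by (auto intro!: wf_fsubst_sb[OF wf(3)])
      \<comment> \<open>Otherwise the head of \<open>z\<close> would be a standard witness for
        \<open>?C\<close>.\<close>
      have p: "P_derives ?G3 ?D3 (Neg ?p')"
      proof (rule NegI[OF wfp NegE])
        show "P_derives ?G3 (?p' # ?D3) (Neg (flift ?C))"
          using wf_lift[OF wfC] by (intro hypI) auto
        have "P_derives ?G3 (?p' # ?D3) (St \<tau> (headF \<tau> \<cdot> Var 0))"
          by (rule St_app[OF St_closed weaken1[OF st]]) simp
        moreover have "P_derives ?G3 (?p' # ?D3) ?p'"
          using wfp by (intro hypI) auto
        ultimately show "P_derives ?G3 (?p' # ?D3) (flift ?C)"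
          using wf_lift[OF wfC] by simp (rule ExStI[where t = "headF \<tau> \<cdot> Var 0"], auto)
      qed
      have "P_derives ?G1 ?D2 (Forall (Seq \<tau>) (Imp ?m (Conj ?r' (Conj ?b' (Neg ?p')))))"
        by (intro allI impI ConjI r b p) auto
      then show "P_derives ?G1 ?D2 (fsubst (sb [Var 2] 0) ?q)"
        by (simp add: counterexample_def)
    qed (auto intro!: wf_fsubst_sb[OF wf_counterexample])
    then have "P_derives ?G1 ?D2 ?r"
      by (simp add: refuted_def)
    moreover have "P_derives ?G1 ?D2 (Neg ?r)"
      using wfr by (intro hypI) auto
    ultimately have "P_derives ?G1 ?D1 ?C"
      by - (rule classical[OF wfC NegE])
    \<comment> \<open>Both keep \<open>y\<close> and shift everything else past \<open>w\<close>, so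
      \<open>?C\<close> is the lifted goal.\<close>
    moreover have "sb [Var 0, Var 2, Var 3] 4 = sb [Var 0] 2"
      by (auto simp: sb_def fun_eq_iff nth_Cons split: nat.split)
    ultimately show "P_derives ?G1 ?D1 (flift (ExSt \<tau> \<phi>))"
      by simp
  qed (use wf in simp)
qed

text \<open>The matrix is \<open>Neg refuted\<close>: every \<open>\<epsilon>\<close> has an entry
  \<open>z\<close> of \<open>w\<close> for which \<open>\<rho>\<close> and the bound at the length
  of \<open>z\<close> imply \<open>\<phi>\<close> at the head of \<open>z\<close>.\<close>

lemma normal_form:
  "\<exists>\<theta>. internal \<theta> \<and> wf_fm (Seq (Seq \<tau>) # \<sigma> # \<Gamma>) \<theta> \<and>
     P_proves \<Gamma> (Iff (Forall \<epsilon> (Imp \<rho> (Imp (AllSt N \<beta>) (AllSt \<sigma> (ExSt \<tau> \<phi>)))))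
                     (AllSt \<sigma> (ExSt (Seq (Seq \<tau>)) \<theta>)))"
proof (intro exI conjI)
  show "P_proves \<Gamma> (Iff (Forall \<epsilon> (Imp \<rho> (Imp (AllSt N \<beta>) (AllSt \<sigma> (ExSt \<tau> \<phi>)))))
      (AllSt \<sigma> (ExSt (Seq (Seq \<tau>)) (Neg refuted))))"
    using IffI[OF normal_form_forward normal_form_backward] by (simp add: original_def)
qed (use internal_refuted wf_refuted in auto)

end

theorem theoremC2:
  fixes \<Gamma> :: "ty list" and \<sigma> \<tau> :: ty and \<phi> :: fm
  assumes "internal \<phi>"
    and "wf_fm (\<tau> # \<sigma> # RealTy # \<Gamma>) \<phi>"
  shows "\<exists>us vs \<theta>. internal \<theta> \<and> wf_fm (rev vs @ rev us @ \<Gamma>) \<theta> \<and>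
           P_proves \<Gamma> (Iff (AllInfinitesimal (AllSt \<sigma> (ExSt \<tau> \<phi>)))
                           (foldr AllSt us (foldr ExSt vs \<theta>)))"
proof -
  let ?\<rho> = "IsReal (Var 0)"
  \<comment> \<open>The term \<open>lift 1 (Var 0)\<close> is \<open>\<epsilon>\<close> seen from
    below the quantifier over \<open>k\<close>.\<close>
  let ?\<beta> = "Imp (Neg (Eql N (Var 0) zero)) (AbsLessRecip (lift 1 (Var 0)) (Var 0))"
  have eq: "AllInfinitesimal (AllSt \<sigma> (ExSt \<tau> \<phi>)) =
      Forall RealTy (Imp ?\<rho> (Imp (AllSt N ?\<beta>) (AllSt \<sigma> (ExSt \<tau> \<phi>))))"
    by (simp add: AllInfinitesimal_def AllReal_def Infinitesimal_def)
  have "\<exists>\<theta>. internal \<theta> \<and> wf_fm (Seq (Seq \<tau>) # \<sigma> # \<Gamma>) \<theta> \<and>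
      P_proves \<Gamma> (Iff (AllInfinitesimal (AllSt \<sigma> (ExSt \<tau> \<phi>)))
                      (AllSt \<sigma> (ExSt (Seq (Seq \<tau>)) \<theta>)))"
    unfolding eq by (rule normal_form) (use assms in \<open>simp_all add: has_ty_iff internal_IsReal
        internal_AbsLessRecip wf_IsReal wf_AbsLessRecip[simplified]\<close>)
  then obtain \<theta> where "internal \<theta>" "wf_fm (Seq (Seq \<tau>) # \<sigma> # \<Gamma>) \<theta>"
      "P_proves \<Gamma> (Iff (AllInfinitesimal (AllSt \<sigma> (ExSt \<tau> \<phi>)))
                      (AllSt \<sigma> (ExSt (Seq (Seq \<tau>)) \<theta>)))"
    by blast
  then show ?thesis
    \<comment> \<open>Both tuples have length one: \<open>u\<close> is \<open>x\<close>, and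
      \<open>v\<close> is the sequence \<open>w\<close> of sequences.\<close>
    by (intro exI[of _ "[\<sigma>]"] exI[of _ "[Seq (Seq \<tau>)]"] exI[of _ \<theta>]) simp
qed

end
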